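(* The Dirichlet series $W_d(s)=\sum_{p/q\in\mathcal S}p^{-s}$ and $W_m(s)=\sum_{p/q\in\mathcal S}q^{-s}$ converge absolutely and are analytic for $\Re(s)>1$, and each has a pole of order $1$ at $s=1$. Consequently $\zeta_{\mathrm{WR}(\mathbb Z^2)}(s)=\sum_{\Lambda\in\mathrm{WR}(\mathbb Z^2)}\det(\Lambda)^{-s}$ and $\zeta^m_{\mathrm{WR}(\mathbb Z^2)}(s)=\sum_{\Lambda\in\mathrm{WR}(\mathbb Z^2)}|\Lambda|^{-2s}$ are analytic for $\Re(s)>1$ and each has a pole of order $2$ at $s=1$.
   Context: All lattices are full-rank lattices in $\mathbb R^2$. For a lattice $\Lambda$, $|\Lambda|=\min_{x\in\Lambda\setminus\{0\}}\|x\|$ (Euclidean norm); $\Lambda$ is well-rounded (WR) if its vectors of norm $|\Lambda|$ span $\mathbb R^2$. $\mathrm{WR}(\mathbb Z^2)$ is the set of full-rank WR sublattices of $\mathbb Z^2$. For $q\in\mathbb Z_{>0}$ let $\mathcal S_q=\{p/q\in\mathbb Q\cap(\sqrt3/2,1):\gcd(p,q)=1,\ \sqrt{q^2-p^2}\in\mathbb Z\}$ and $\mathcal S=\bigcup_{q}\mathcal S_q\cup\{1\}$, where $1$ is written as $p/q$ with $p=q=1$; elements of $\mathcal S$ are written in lowest terms (the sums above run over all elements $p/q$ of $\mathcal S$, each once). Pole convention: a Dirichlet series $\sum_{n\ge1}c_nn^{-s}$ has a pole of order $\mu>0$ at the real point $s_0$ if $0<\lim_{s\to s_0^+}|s-s_0|^{\mu}\sum_{n\ge1}|c_nn^{-s}|<\infty$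 ($s$ real); this does not assert analytic continuation. *)

theory Defs
  imports "HOL-Analysis.Analysis"
begin

text \<open>The set S of reduced fractions p/q in (sqrt 3/2, 1) with sqrt(q^2-p^2) integral,
  together with 1 = 1/1; a fraction is represented by its pair (p, q) in lowest terms.\<close>
definition S_set :: "(nat \<times> nat) set" where
  "S_set = {(p, q). 0 < q \<and> coprime p q \<and> sqrt 3 / 2 < real p / real q \<and> real p / real q < 1
                    \<and> (\<exists>k::nat. k ^ 2 = q ^ 2 - p ^ 2)} \<union> {(1, 1)}"

definition det2 :: "int \<times> int \<Rightarrow> int \<times> int \<Rightarrow> int" where
  "det2 u v = fst u * snd v - snd u * fst v"

definition zspan2 :: "int \<times> int \<Rightarrow> int \<times> int \<Rightarrow> (int \<times> int) set" where
  "zspan2 u v = {(i * fst u + j * fst v, i * snd u + j * snd v) | i j. True}"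

definition full_rank_sublattice :: "(int \<times> int) set \<Rightarrow> bool" where
  "full_rank_sublattice L \<longleftrightarrow> (\<exists>u v. det2 u v \<noteq> 0 \<and> L = zspan2 u v)"

definition lattice_det :: "(int \<times> int) set \<Rightarrow> real" where
  "lattice_det L = (THE D. \<exists>u v. det2 u v \<noteq> 0 \<and> L = zspan2 u v \<and> D = real_of_int \<bar>det2 u v\<bar>)"

definition inorm :: "int \<times> int \<Rightarrow> real" where
  "inorm x = sqrt (real_of_int (fst x ^ 2 + snd x ^ 2))"

definition lattice_min :: "(int \<times> int) set \<Rightarrow> real" where
  "lattice_min L = Inf (inorm ` (L - {(0, 0)}))"

text \<open>Well-rounded: the minimal vectors span R^2, i.e. two of them are linearly independent.\<close>
definition well_rounded :: "(int \<times> int) set \<Rightarrow> bool" where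
  "well_rounded L \<longleftrightarrow> (\<exists>u\<in>L. \<exists>v\<in>L. u \<noteq> (0, 0) \<and> v \<noteq> (0, 0)
       \<and> inorm u = lattice_min L \<and> inorm v = lattice_min L \<and> det2 u v \<noteq> 0)"

definition WR_Z2 :: "(int \<times> int) set set" where
  "WR_Z2 = {L. full_rank_sublattice L \<and> well_rounded L}"

end

theory Submission
  imports Defs "HOL-Complex_Analysis.Complex_Analysis" "HOL-Computational_Algebra.Nth_Powers"
begin

text \<open>
  Everything reduces to sums of $F(a,b)^{-s}$ over integer points $(a,b)$ of a planar sector with
  prescribed parities, where $F$ is a positive quadratic form. Writing $F(a,b) = a^2 f(b/a)$, the sum
  over $b$ is a Riemann sum, so the whole sum behaves like a constant multiple of
  $\sum_a a^{1-2s}$ and has a simple pole at $s = 1$. Coprimality of $(a,b)$ is enforced by dividing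
  by $\sum_{d\ \mathrm{odd}} d^{-2s}$, which is continuous and positive at $s = 1$.

  The elements of the set S are parametrised by coprime $a \le b$ with $b^2 < 3a^2$ through
  $p = c\,ab$ and $q = c\,(a^2+b^2)/2$, where $c = 1$ if $a, b$ are odd and $c = 2$ otherwise.
  In a well-rounded lattice with minimal basis $u, v$ the diagonals $u + v$ and $u - v$ of the
  rhombus are orthogonal, hence of the form $az$ and $b\,iz$ with a Gaussian integer $z$ and coprime
  $a, b > 0$. This is unique once $z$ is normalised modulo units; the determinant is
  $ab|z|^2/2$ and the squared minimum $(a^2+b^2)|z|^2/4$. Both zeta functions thus become sums of
  two products of a series over $z$ and a series over $(a,b)$, each factor with a simple pole.
\<close>

section \<open>Dirichlet series over arbitrary index sets\<close>


text \<open>The limiting constants are never evaluated; only their positivity matters, and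
  contributions of different parity classes cannot cancel. The classes come from two integrality
  questions: $c$ depends on the parities of $a, b$, and $u = (a + ib)z/2$ has integer coordinates
  only if the parities of $z$ and $(a, b)$ fit together. The latter keeps the lattices from forming
  a single Cartesian product and leaves two.

  The delicate point is that the inner Riemann sum depends on $s$ as well as on $a$, while the limit
  at $s = 1$ is taken after summing over all $a$. The weights $(s-1)a^{1-2s}$ move all mass to large
  $a$ as $s$ tends to 1, so it suffices to control the inner sum for large $a$, uniformly for $s$
  near 1.

  The number 3 enters through the hexagonal lattice, whose angle of 60 degrees bounds the
  well-rounded region. Irrationality of the square root of 3 keeps that lattice out of $Z^2$, so a
  minimal basis is unique up to signs and order; this is what makes the parametrisation a
  bijection.\<close>

text \<open>The conditions are bundled so as to be stable under bijections, disjoint unions and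
  products of index sets. Only real \<open>s\<close> occurs, because analyticity for complex
  \<open>s\<close> follows from absolute convergence.\<close>

definition dirichlet_pole :: "nat \<Rightarrow> ('a \<Rightarrow> real) \<Rightarrow> 'a set \<Rightarrow> bool" where
  "dirichlet_pole m F X \<longleftrightarrow> (\<forall>x\<in>X. F x > 0) \<and>
     (\<forall>s>1. (\<lambda>x. F x powr (- s)) summable_on X) \<and>
     (\<exists>c>0. ((\<lambda>s. (s - 1) ^ m * (\<Sum>\<^sub>\<infinity>x\<in>X. F x powr (- s))) \<longlongrightarrow> c) (at_right 1))"

lemma dirichlet_series_abs_summable:
  fixes F :: "'a \<Rightarrow> real"
  assumes pos: "\<And>x. x \<in> X \<Longrightarrow> F x > 0"
    and summ: "\<And>s. s > 1 \<Longrightarrow> (\<lambda>x. F x powr (- s)) summable_on X"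
    and s: "Re s > 1"
  shows "(\<lambda>x. norm (complex_of_real (F x) powr (- s))) summable_on X"
proof -
  have "norm (complex_of_real (F x) powr (- s)) = F x powr (- Re s)" if "x \<in> X" for x
    using pos[OF that] by (simp add: norm_powr_real_powr)
  then show ?thesis using summ[OF s] by (simp cong: summable_on_cong)
qed

text \<open>Finite partial sums are entire and converge uniformly on small closed discs by the
  Weierstrass M-test, taken along the net of finite subsets of \<open>X\<close>.\<close>

lemma dirichlet_series_analytic:
  fixes F :: "'a \<Rightarrow> real"
  assumes pos: "\<And>x. x \<in> X \<Longrightarrow> F x > 0"
    and summ: "\<And>s. s > 1 \<Longrightarrow> (\<lambda>x. F x powr (- s)) summable_on X"
  shows "(\<lambda>s. \<Sum>\<^sub>\<infinity>x\<in>X. complex_of_real (F x) powr (- s)) analytic_on {s. Re s > 1}"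
proof -
  let ?f = "\<lambda>s. \<Sum>\<^sub>\<infinity>x\<in>X. complex_of_real (F x) powr (- s)"
  have "?f analytic_on {z}" if z: "Re z > 1" for z
  proof -
    define r where "r = (Re z - 1) / 2"
    have r: "r > 0" "Re z - r > 1" using z by (auto simp: r_def field_simps)
    \<comment> \<open>Values of \<open>F\<close> below 1 are allowed, and there the power grows with
      the exponent. Adding the powers at both ends of the real range of the disc gives a majorant in
      either case.\<close>
    define M where "M = (\<lambda>x. F x powr (- (Re z - r)) + F x powr (- (Re z + r)))"
    have bound: "norm (complex_of_real (F x) powr (- s)) \<le> M x" if "x \<in> X" "s \<in> cball z r" for x s
    proof -
      have "\<bar>Re (z - s)\<bar> \<le> r"
        using that(2) abs_Re_le_cmod[of "z - s"] by (simp add: dist_norm)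
      then have *: "Re z - r \<le> Re s" "Re s \<le> Re z + r" by auto
      have "norm (complex_of_real (F x) powr (- s)) = F x powr (- Re s)"
        using pos[OF that(1)] by (simp add: norm_powr_real_powr)
      also have "\<dots> \<le> M x"
      proof (cases "F x \<ge> 1")
        case True
        then have "F x powr (- Re s) \<le> F x powr (- (Re z - r))"
          using * by (intro powr_mono) auto
        then show ?thesis by (simp add: M_def add_increasing2)
      next
        case False
        then have "F x powr (- Re s) \<le> F x powr (- (Re z + r))"
          using * pos[OF that(1)] by (intro powr_mono') auto
        then show ?thesis by (simp add: M_def add_increasing)
      qed
      finally show ?thesis .
    qed
    have "M summable_on X"
      unfolding M_def using r by (intro summable_on_add summ) auto
    then have ul: "uniform_limit (cball z r) (\<lambda>Y s. \<Sum>x\<in>Y. complex_of_real (F x) powr (- s)) ?f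
        (finite_subsets_at_top X)"
      by (intro Weierstrass_m_test_general[where M = M] bound)
    have hol: "(\<lambda>s. \<Sum>x\<in>Y. complex_of_real (F x) powr (- s)) holomorphic_on UNIV" if "Y \<subseteq> X" for Y
      using that pos by (intro holomorphic_intros) (force simp: complex_nonpos_Reals_iff)+
    have "eventually (\<lambda>Y. Y \<subseteq> X) (finite_subsets_at_top X)"
      by (auto simp: eventually_finite_subsets_at_top)
    then have ev: "eventually (\<lambda>Y. continuous_on (cball z r) (\<lambda>s. \<Sum>x\<in>Y. complex_of_real (F x) powr (- s)) \<and>
        (\<lambda>s. \<Sum>x\<in>Y. complex_of_real (F x) powr (- s)) holomorphic_on ball z r) (finite_subsets_at_top X)"
      by eventually_elim
        (use hol holomorphic_on_subset holomorphic_on_imp_continuous_on in \<open>blast intro: subset_UNIV\<close>)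
    have "?f holomorphic_on ball z r"
      by (rule holomorphic_uniform_limit[OF ev ul]) auto
    then show ?thesis
      using r(1) analytic_at_ball by blast
  qed
  then show ?thesis by (subst analytic_on_analytic_at) auto
qed

text \<open>Read off from the complex series on the real axis. It is what later permits evaluating a
  convergent factor at an interior point.\<close>

lemma dirichlet_series_continuous:
  fixes F :: "'a \<Rightarrow> real"
  assumes pos: "\<And>x. x \<in> X \<Longrightarrow> F x > 0"
    and summ: "\<And>s. s > 1 \<Longrightarrow> (\<lambda>x. F x powr (- s)) summable_on X"
    and s: "s > 1"
  shows "isCont (\<lambda>s. \<Sum>\<^sub>\<infinity>x\<in>X. F x powr (- s)) s"
proof -
  let ?f = "\<lambda>s. \<Sum>\<^sub>\<infinity>x\<in>X. complex_of_real (F x) powr (- s)"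
  have "?f analytic_on {s. Re s > 1}"
    by (rule dirichlet_series_analytic[OF pos summ])
  then have c: "continuous_on {s. Re s > 1} ?f"
    using analytic_imp_holomorphic holomorphic_on_imp_continuous_on by blast
  have "?f (complex_of_real t) = of_real (\<Sum>\<^sub>\<infinity>x\<in>X. F x powr (- t))" if "t > 1" for t
  proof -
    have "?f (complex_of_real t) = (\<Sum>\<^sub>\<infinity>x\<in>X. of_real (F x powr (- t)))"
      using pos by (intro infsum_cong) (metis less_imp_le of_real_minus powr_of_real)
    also have "\<dots> = of_real (\<Sum>\<^sub>\<infinity>x\<in>X. F x powr (- t))"
      by (intro infsumI has_sum_of_real has_sum_infsum summ that)
    finally show ?thesis .
  qed
  then have eq: "(\<Sum>\<^sub>\<infinity>x\<in>X. F x powr (- t)) = Re (?f (complex_of_real t))" if "t \<in> {1<..}" for t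
    using that by simp
  have "continuous_on {1<..} (\<lambda>t. Re (?f (complex_of_real t)))"
    by (intro continuous_intros continuous_on_compose2[OF c]) auto
  then have "continuous_on {1<..} (\<lambda>t. \<Sum>\<^sub>\<infinity>x\<in>X. F x powr (- t))"
    using eq by (subst continuous_on_cong[OF refl]) auto
  then show ?thesis
    using s by (auto simp: continuous_on_eq_continuous_at)
qed

lemma dirichlet_pole_cong:
  assumes "\<And>x. x \<in> X \<Longrightarrow> F x = G x"
  shows "dirichlet_pole m F X \<longleftrightarrow> dirichlet_pole m G X"
  using assms unfolding dirichlet_pole_def
  by (simp cong: summable_on_cong infsum_cong)

lemma dirichlet_pole_bij_betw_iff:
  assumes bij: "bij_betw h Y X"
  shows "dirichlet_pole m F X \<longleftrightarrow> dirichlet_pole m (\<lambda>y. F (h y)) Y"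
proof -
  have "(\<forall>x\<in>X. F x > 0) \<longleftrightarrow> (\<forall>y\<in>Y. F (h y) > 0)"
    using bij by (auto simp: bij_betw_def)
  then show ?thesis
    unfolding dirichlet_pole_def
    by (simp add: summable_on_reindex_bij_betw[OF bij, where f = "\<lambda>x. F x powr _"]
          infsum_reindex_bij_betw[OF bij, where f = "\<lambda>x. F x powr _"])
qed

lemma dirichlet_pole_bij_betw:
  assumes bij: "bij_betw h Y X" and eq: "\<And>y. y \<in> Y \<Longrightarrow> F (h y) = G y"
    and pole: "dirichlet_pole m G Y"
  shows "dirichlet_pole m F X"
  using pole eq by (simp add: dirichlet_pole_bij_betw_iff[OF bij] cong: dirichlet_pole_cong)

lemma dirichlet_pole_Un:
  assumes X: "dirichlet_pole m F X" and Y: "dirichlet_pole m F Y" and disj: "X \<inter> Y = {}"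
  shows "dirichlet_pole m F (X \<union> Y)"
proof -
  obtain c d where cd: "c > 0" "d > 0"
    "((\<lambda>s. (s - 1) ^ m * (\<Sum>\<^sub>\<infinity>x\<in>X. F x powr (- s))) \<longlongrightarrow> c) (at_right 1)"
    "((\<lambda>s. (s - 1) ^ m * (\<Sum>\<^sub>\<infinity>x\<in>Y. F x powr (- s))) \<longlongrightarrow> d) (at_right 1)"
    using X Y by (auto simp: dirichlet_pole_def)
  have sX: "(\<lambda>x. F x powr (- s)) summable_on X" and sY: "(\<lambda>x. F x powr (- s)) summable_on Y"
    if "s > 1" for s
    using X Y that by (auto simp: dirichlet_pole_def)
  have "((\<lambda>s. (s - 1) ^ m * (\<Sum>\<^sub>\<infinity>x\<in>X \<union> Y. F x powr (- s))) \<longlongrightarrow> c + d) (at_right 1)"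
  proof (rule Lim_transform_eventually[OF tendsto_add[OF cd(3,4)]])
    show "\<forall>\<^sub>F s in at_right 1. (s - 1) ^ m * (\<Sum>\<^sub>\<infinity>x\<in>X. F x powr (- s)) +
        (s - 1) ^ m * (\<Sum>\<^sub>\<infinity>x\<in>Y. F x powr (- s)) = (s - 1) ^ m * (\<Sum>\<^sub>\<infinity>x\<in>X \<union> Y. F x powr (- s))"
      using eventually_at_right_less[of "1::real"]
      by eventually_elim (simp add: infsum_Un_disjoint[OF sX sY disj] ring_distribs)
  qed
  moreover have "c + d > 0" using cd by simp
  ultimately show ?thesis
    using X Y summable_on_Un_disjoint[OF sX sY disj] unfolding dirichlet_pole_def by blast
qed

text \<open>The double series of positive terms factors into the two single series, so pole orders
  add and limits multiply.\<close>

lemma dirichlet_pole_Times: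
  assumes X: "dirichlet_pole m F X" and Y: "dirichlet_pole n G Y"
  shows "dirichlet_pole (m + n) (\<lambda>(x, y). F x * G y) (X \<times> Y)"
proof -
  obtain c d where cd: "c > 0" "d > 0"
    "((\<lambda>s. (s - 1) ^ m * (\<Sum>\<^sub>\<infinity>x\<in>X. F x powr (- s))) \<longlongrightarrow> c) (at_right 1)"
    "((\<lambda>s. (s - 1) ^ n * (\<Sum>\<^sub>\<infinity>x\<in>Y. G x powr (- s))) \<longlongrightarrow> d) (at_right 1)"
    using X Y by (auto simp: dirichlet_pole_def)
  have pos: "F x > 0" "G y > 0" if "x \<in> X" "y \<in> Y" for x y
    using X Y that by (auto simp: dirichlet_pole_def)
  have sX: "(\<lambda>x. F x powr (- s)) summable_on X" and sY: "(\<lambda>x. G x powr (- s)) summable_on Y"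
    if "s > 1" for s
    using X Y that by (auto simp: dirichlet_pole_def)
  have mult: "(case z of (x, y) \<Rightarrow> F x * G y) powr (- s) = (case z of (x, y) \<Rightarrow> F x powr (- s) * G y powr (- s))"
    if "z \<in> X \<times> Y" for z s
    using that pos by (auto simp: powr_mult)
  have prod: "((\<lambda>z. (case z of (x, y) \<Rightarrow> F x * G y) powr (- s)) has_sum
      (\<Sum>\<^sub>\<infinity>x\<in>X. F x powr (- s)) * (\<Sum>\<^sub>\<infinity>y\<in>Y. G y powr (- s))) (X \<times> Y)" if s: "s > 1" for s
  proof -
    have "((\<lambda>(x, y). F x powr (- s) * G y powr (- s)) has_sum
        (\<Sum>\<^sub>\<infinity>x\<in>X. F x powr (- s)) * (\<Sum>\<^sub>\<infinity>y\<in>Y. G y powr (- s))) (X \<times> Y)"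
    proof (rule has_sum_SigmaI)
      show "((\<lambda>y. case (x, y) of (x, y) \<Rightarrow> F x powr (- s) * G y powr (- s)) has_sum
        F x powr (- s) * (\<Sum>\<^sub>\<infinity>y\<in>Y. G y powr (- s))) Y" for x
        using has_sum_cmult_right[OF has_sum_infsum[OF sY[OF s]]] by simp
      show "((\<lambda>x. F x powr (- s) * (\<Sum>\<^sub>\<infinity>y\<in>Y. G y powr (- s))) has_sum
        (\<Sum>\<^sub>\<infinity>x\<in>X. F x powr (- s)) * (\<Sum>\<^sub>\<infinity>y\<in>Y. G y powr (- s))) X"
        by (rule has_sum_cmult_left[OF has_sum_infsum[OF sX[OF s]]])
      show "(\<lambda>(x, y). F x powr (- s) * G y powr (- s)) summable_on X \<times> Y"
        by (rule summable_on_SigmaI[where g = "\<lambda>x. F x powr (- s) * (\<Sum>\<^sub>\<infinity>y\<in>Y. G y powr (- s))"])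
           (use has_sum_cmult_right[OF has_sum_infsum[OF sY[OF s]]] sX[OF s] in
             \<open>auto intro!: summable_on_cmult_left\<close>)
    qed
    then show ?thesis
      by (subst has_sum_cong[OF mult])
  qed
  have "((\<lambda>s. (s - 1) ^ (m + n) * (\<Sum>\<^sub>\<infinity>z\<in>X \<times> Y. (case z of (x, y) \<Rightarrow> F x * G y) powr (- s))) \<longlongrightarrow> c * d) (at_right 1)"
  proof (rule Lim_transform_eventually[OF tendsto_mult[OF cd(3,4)]])
    show "\<forall>\<^sub>F s in at_right 1. (s - 1) ^ m * (\<Sum>\<^sub>\<infinity>x\<in>X. F x powr (- s)) *
        ((s - 1) ^ n * (\<Sum>\<^sub>\<infinity>x\<in>Y. G x powr (- s))) =
        (s - 1) ^ (m + n) * (\<Sum>\<^sub>\<infinity>z\<in>X \<times> Y. (case z of (x, y) \<Rightarrow> F x * G y) powr (- s))"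
      using eventually_at_right_less[of "1::real"]
      by eventually_elim (simp add: infsumI[OF prod] power_add)
  qed
  moreover have "c * d > 0" using cd by simp
  moreover have "\<forall>z\<in>X \<times> Y. (case z of (x, y) \<Rightarrow> F x * G y) > 0" using pos by auto
  ultimately show ?thesis
    using has_sum_imp_summable[OF prod] unfolding dirichlet_pole_def by blast
qed

text \<open>The double series is \<open>E s\<close> times the series of \<open>F\<close>.
  Convergence of \<open>E\<close> already for \<open>s > 1 / 2\<close> makes it continuous at 1, and
  since it is positive there the pole passes entirely to the second factor. The value 1/2 is the
  abscissa that arises when \<open>D\<close> runs over squares.\<close>

lemma dirichlet_pole_divide:
  fixes D :: "'a \<Rightarrow> real"
  assumes XY: "dirichlet_pole m (\<lambda>(x, y). D x * F y) (X \<times> Y)"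
    and D: "\<And>s. s > 1 / 2 \<Longrightarrow> (\<lambda>x. D x powr (- s)) summable_on X" "\<And>x. x \<in> X \<Longrightarrow> D x > 0"
    and ne: "X \<noteq> {}"
  shows "dirichlet_pole m F Y"
proof -
  define E where "E s = (\<Sum>\<^sub>\<infinity>x\<in>X. D x powr (- s))" for s
  obtain c where c: "c > 0"
    "((\<lambda>s. (s - 1) ^ m * (\<Sum>\<^sub>\<infinity>z\<in>X \<times> Y. (case z of (x, y) \<Rightarrow> D x * F y) powr (- s))) \<longlongrightarrow> c) (at_right 1)"
    using XY by (auto simp: dirichlet_pole_def)
  have summ: "(\<lambda>z. (case z of (x, y) \<Rightarrow> D x * F y) powr (- s)) summable_on X \<times> Y" if "s > 1" for s
    using XY that by (auto simp: dirichlet_pole_def)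
  obtain x0 where x0: "x0 \<in> X" using ne by blast
  have "\<forall>z\<in>X \<times> Y. (case z of (x, y) \<Rightarrow> D x * F y) > 0"
    using XY by (auto simp: dirichlet_pole_def)
  then have "D x0 * F y > 0" if "y \<in> Y" for y
    using x0 that by auto
  then have posF: "F y > 0" if "y \<in> Y" for y
    using D(2)[OF x0] that zero_less_mult_pos by blast
  have sY: "(\<lambda>y. F y powr (- s)) summable_on Y" if s: "s > 1" for s
  proof -
    have "(\<lambda>y. (D x0 * F y) powr (- s)) summable_on Y"
      using summable_on_SigmaD1[where f = "\<lambda>x y. (D x * F y) powr (- s)" and x = x0 and A = X and B = "\<lambda>_. Y"] summ[OF s] x0
      by (auto simp: case_prod_unfold)
    moreover have "(D x0 * F y) powr (- s) = D x0 powr (- s) * F y powr (- s)" if "y \<in> Y" for y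
      using posF[OF that] D(2)[OF x0] by (simp add: powr_mult)
    ultimately have "(\<lambda>y. D x0 powr (- s) * F y powr (- s)) summable_on Y"
      by (simp cong: summable_on_cong)
    then show ?thesis
      using D(2)[OF x0] by (subst (asm) summable_on_cmult_right') auto
  qed
  have E_pos: "E s > 0" if "s > 1 / 2" for s
  proof -
    have "0 < D x0 powr (- s)" using D(2)[OF x0] by simp
    also have "\<dots> = (\<Sum>x\<in>{x0}. D x powr (- s))" by simp
    also have "\<dots> \<le> E s"
      unfolding E_def using x0 that by (intro finite_sum_le_infsum D) auto
    finally show ?thesis .
  qed
  have eq: "(\<Sum>\<^sub>\<infinity>z\<in>X \<times> Y. (case z of (x, y) \<Rightarrow> D x * F y) powr (- s)) = E s * (\<Sum>\<^sub>\<infinity>y\<in>Y. F y powr (- s))"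
    if s: "s > 1" for s
  proof -
    have "(\<Sum>\<^sub>\<infinity>z\<in>X \<times> Y. (case z of (x, y) \<Rightarrow> D x * F y) powr (- s)) =
        (\<Sum>\<^sub>\<infinity>x\<in>X. \<Sum>\<^sub>\<infinity>y\<in>Y. (D x * F y) powr (- s))"
      using infsum_Sigma_banach[OF summ[OF s]] by simp
    also have "\<dots> = (\<Sum>\<^sub>\<infinity>x\<in>X. \<Sum>\<^sub>\<infinity>y\<in>Y. D x powr (- s) * F y powr (- s))"
      using D(2) posF by (intro infsum_cong) (simp add: powr_mult)
    also have "\<dots> = E s * (\<Sum>\<^sub>\<infinity>y\<in>Y. F y powr (- s))"
      unfolding E_def by (simp add: infsum_cmult_right' infsum_cmult_left')
    finally show ?thesis .
  qed
  \<comment> \<open>Continuity is available only to the right of abscissa 1. Passing to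
    \<open>sqrt (D x)\<close> doubles the exponent and moves the point 1 to 2.\<close>
  have "isCont (\<lambda>s. \<Sum>\<^sub>\<infinity>x\<in>X. sqrt (D x) powr (- s)) 2"
  proof (rule dirichlet_series_continuous)
    show "(\<lambda>x. sqrt (D x) powr (- s)) summable_on X" if "s > 1" for s
      using D(1)[of "s / 2"] that D(2)
      by (subst summable_on_cong[where g = "\<lambda>x. D x powr (- (s / 2))"])
         (auto simp: powr_half_sqrt[symmetric] powr_powr less_imp_le)
  qed (use D in auto)
  then have "isCont (\<lambda>s. \<Sum>\<^sub>\<infinity>x\<in>X. sqrt (D x) powr (- (2 * s))) 1"
    by (intro isCont_o2[where f = "\<lambda>s. 2 * s" and g = "\<lambda>s. \<Sum>\<^sub>\<infinity>x\<in>X. sqrt (D x) powr (- s)"]) auto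
  moreover have "(\<Sum>\<^sub>\<infinity>x\<in>X. sqrt (D x) powr (- (2 * s))) = E s" for s
    unfolding E_def using D(2)
    by (intro infsum_cong) (auto simp: powr_half_sqrt[symmetric] powr_powr less_imp_le)
  ultimately have "isCont E 1" by simp
  then have "(E \<longlongrightarrow> E 1) (at_right 1)"
    by (simp add: isCont_def filterlim_at_split)
  then have lim: "((\<lambda>s. (s - 1) ^ m * (\<Sum>\<^sub>\<infinity>z\<in>X \<times> Y. (case z of (x, y) \<Rightarrow> D x * F y) powr (- s)) / E s)
      \<longlongrightarrow> c / E 1) (at_right 1)"
    using c(2) E_pos[of 1] by (intro tendsto_divide) auto
  have "((\<lambda>s. (s - 1) ^ m * (\<Sum>\<^sub>\<infinity>y\<in>Y. F y powr (- s))) \<longlongrightarrow> c / E 1) (at_right 1)"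
  proof (rule Lim_transform_eventually[OF lim])
    show "\<forall>\<^sub>F s in at_right 1. (s - 1) ^ m *
        (\<Sum>\<^sub>\<infinity>z\<in>X \<times> Y. (case z of (x, y) \<Rightarrow> D x * F y) powr (- s)) / E s =
        (s - 1) ^ m * (\<Sum>\<^sub>\<infinity>y\<in>Y. F y powr (- s))"
      using eventually_at_right_less[of "1::real"]
      by eventually_elim (use E_pos eq in \<open>simp add: less_imp_neq[symmetric]\<close>)
  qed
  moreover have "c / E 1 > 0" using c E_pos[of 1] by simp
  ultimately show ?thesis
    using posF sY unfolding dirichlet_pole_def by blast
qed

section \<open>Arithmetic progressions and Riemann sums\<close>


text \<open>Toeplitz averaging: every fixed weight dies out while the total mass tends to \<kappa>,
  so only large \<open>n\<close> count and \<open>x n s\<close> may be replaced by \<open>l\<close>.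
  In the last hypothesis \<open>N\<close> is chosen before \<open>s\<close>; this is the uniformity
  required because \<open>x\<close> itself varies with \<open>s\<close>.\<close>

lemma tendsto_suminf_regular_weights:
  fixes W x :: "nat \<Rightarrow> 'b \<Rightarrow> real"
  assumes W: "\<forall>\<^sub>F s in F. (\<forall>n. W n s \<ge> 0) \<and> summable (\<lambda>n. W n s)"
    and total: "((\<lambda>s. \<Sum>n. W n s) \<longlongrightarrow> \<kappa>) F"
    and single: "\<And>n. (W n \<longlongrightarrow> 0) F"
    and bound: "\<forall>\<^sub>F s in F. \<forall>n. \<bar>x n s\<bar> \<le> M"
    and lim: "\<And>\<epsilon>. \<epsilon> > 0 \<Longrightarrow> \<exists>N. \<forall>\<^sub>F s in F. \<forall>n\<ge>N. \<bar>x n s - l\<bar> < \<epsilon>"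
  shows "((\<lambda>s. \<Sum>n. W n s * x n s) \<longlongrightarrow> \<kappa> * l) F"
proof -
  have "((\<lambda>s. (\<Sum>n. W n s * x n s) - (\<Sum>n. W n s) * l) \<longlongrightarrow> 0) F"
  proof (rule tendstoI)
    fix \<eta> :: real assume \<eta>: "\<eta> > 0"
    define \<epsilon> where "\<epsilon> = \<eta> / (2 * (\<bar>\<kappa>\<bar> + 1))"
    have \<epsilon>: "\<epsilon> > 0" using \<eta> by (simp add: \<epsilon>_def)
    obtain N where N: "\<forall>\<^sub>F s in F. \<forall>n\<ge>N. \<bar>x n s - l\<bar> < \<epsilon>" using lim[OF \<epsilon>] by blast
    have "((\<lambda>s. (\<Sum>n<N. W n s) * (M + \<bar>l\<bar>) + \<epsilon> * (\<Sum>n. W n s)) \<longlongrightarrow> (\<Sum>n<N. 0) * (M + \<bar>l\<bar>) + \<epsilon> * \<kappa>) F"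
      by (intro tendsto_intros single total)
    moreover have "\<epsilon> * \<kappa> < \<eta>"
    proof -
      have "\<epsilon> * \<kappa> \<le> \<epsilon> * (\<bar>\<kappa>\<bar> + 1)" using \<epsilon> by (intro mult_left_mono) auto
      also have "\<dots> = \<eta> / 2" by (simp add: \<epsilon>_def field_simps add_nonneg_eq_0_iff)
      finally show ?thesis using \<eta> by simp
    qed
    ultimately have ev: "\<forall>\<^sub>F s in F. (\<Sum>n<N. W n s) * (M + \<bar>l\<bar>) + \<epsilon> * (\<Sum>n. W n s) < \<eta>"
      by (intro order_tendstoD) auto
    show "\<forall>\<^sub>F s in F. dist ((\<Sum>n. W n s * x n s) - (\<Sum>n. W n s) * l) 0 < \<eta>"
      using W N bound ev
    proof eventually_elim
      case (elim s)
      have W0: "W n s \<ge> 0" for n using elim by blast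
      have sW: "summable (\<lambda>n. W n s)" using elim by blast
      \<comment> \<open>Below \<open>N\<close> the deviation is bounded crudely by
        \<open>M + |l|\<close>, which the vanishing weights absorb; from \<open>N\<close> on it is
        at most \<epsilon>.\<close>
      have b: "\<bar>W n s * (x n s - l)\<bar> \<le> (if n < N then W n s * (M + \<bar>l\<bar>) else 0) + \<epsilon> * W n s" for n
      proof (cases "n < N")
        case True
        have "\<bar>x n s - l\<bar> \<le> M + \<bar>l\<bar>" using elim(3)[rule_format, of n] by linarith
        then have "\<bar>W n s * (x n s - l)\<bar> \<le> W n s * (M + \<bar>l\<bar>)"
          using W0[of n] by (simp add: abs_mult mult_left_mono)
        then show ?thesis using True W0[of n] \<epsilon> by (simp add: add_increasing2)
      next
        case False
        then have "\<bar>x n s - l\<bar> \<le> \<epsilon>" using elim(2) by (simp add: less_imp_le)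
        then show ?thesis using W0[of n] False mult_left_mono[of "\<bar>x n s - l\<bar>" \<epsilon> "W n s"] by (simp add: abs_mult mult.commute)
      qed
      have s1: "(\<lambda>n. if n < N then W n s * (M + \<bar>l\<bar>) else 0) sums (\<Sum>n<N. W n s * (M + \<bar>l\<bar>))"
        using sums_If_finite[of "\<lambda>n. n < N" "\<lambda>n. W n s * (M + \<bar>l\<bar>)"] by (simp add: lessThan_def)
      have s2: "(\<lambda>n. (if n < N then W n s * (M + \<bar>l\<bar>) else 0) + \<epsilon> * W n s) sums
          ((\<Sum>n<N. W n s * (M + \<bar>l\<bar>)) + \<epsilon> * (\<Sum>n. W n s))"
        by (intro sums_add s1 sums_mult summable_sums sW)
      have s3: "summable (\<lambda>n. \<bar>W n s * (x n s - l)\<bar>)"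
        by (rule summable_comparison_test'[OF sums_summable[OF s2], of 0]) (use b in auto)
      have s4: "summable (\<lambda>n. W n s * (x n s - l))"
        by (rule summable_rabs_cancel[OF s3])
      have "(\<lambda>n. W n s * (x n s - l) + W n s * l) sums ((\<Sum>n. W n s * (x n s - l)) + (\<Sum>n. W n s) * l)"
        by (intro sums_add sums_mult2 summable_sums s4 sW)
      then have "(\<lambda>n. W n s * x n s) sums ((\<Sum>n. W n s * (x n s - l)) + (\<Sum>n. W n s) * l)"
        by (simp add: algebra_simps)
      then have "(\<Sum>n. W n s * x n s) - (\<Sum>n. W n s) * l = (\<Sum>n. W n s * (x n s - l))"
        by (simp add: sums_iff)
      also have "\<bar>\<dots>\<bar> \<le> (\<Sum>n. \<bar>W n s * (x n s - l)\<bar>)"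
        by (rule summable_rabs[OF s3])
      also have "\<dots> \<le> (\<Sum>n<N. W n s * (M + \<bar>l\<bar>)) + \<epsilon> * (\<Sum>n. W n s)"
        using suminf_le[OF b s3 sums_summable[OF s2]] sums_unique[OF s2] by simp
      also have "\<dots> < \<eta>" using elim(4) by (simp add: sum_distrib_right)
      finally show ?case by (simp add: dist_real_def)
    qed
  qed
  then show ?thesis
    using tendsto_add[OF _ tendsto_mult_right[OF total, of l], of "\<lambda>s. (\<Sum>n. W n s * x n s) - (\<Sum>n. W n s) * l" 0]
    by simp
qed

text \<open>The mean value theorem for \<open>x powr (- e)\<close>. It replaces the comparison with
  an integral by differences that telescope.\<close>

lemma powr_step_bounds:
  fixes x e h :: real
  assumes "x > 0" "e > 0" "h > 0"
  shows "h * e * (x + h) powr (- (1 + e)) \<le> x powr (- e) - (x + h) powr (- e)"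
    and "x powr (- e) - (x + h) powr (- e) \<le> h * e * x powr (- (1 + e))"
proof -
  have "\<exists>z>x. z < x + h \<and> (x + h) powr (- e) - x powr (- e) = (x + h - x) * (- e * z powr (- e - 1))"
    using assms by (intro MVT2) (auto intro!: derivative_eq_intros)
  then obtain z where z: "x < z" "z < x + h"
    "(x + h) powr (- e) - x powr (- e) = h * (- e * z powr (- e - 1))" by auto
  have eq: "x powr (- e) - (x + h) powr (- e) = h * e * z powr (- (1 + e))"
  proof -
    have "- e - 1 = - (1 + e)" by simp
    then have "(x + h) powr (- e) - x powr (- e) = h * (- e * z powr (- (1 + e)))"
      using z(3) by (simp only:)
    then show ?thesis by simp
  qed
  have "(x + h) powr (- (1 + e)) \<le> z powr (- (1 + e))" "z powr (- (1 + e)) \<le> x powr (- (1 + e))"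
    using z assms by (auto intro!: powr_mono2')
  then show "h * e * (x + h) powr (- (1 + e)) \<le> x powr (- e) - (x + h) powr (- e)"
    "x powr (- e) - (x + h) powr (- e) \<le> h * e * x powr (- (1 + e))"
    unfolding eq using assms by (auto intro!: mult_left_mono)
qed

text \<open>Successive differences of \<open>x powr (- e)\<close> enclose the terms and telescope to
  \<open>i powr (- e)\<close>. The two bounds differ only by \<open>h * e\<close> times the first
  term, so they agree in the limit of small \<open>e\<close>.\<close>

lemma arithmetic_progression_zeta:
  fixes i h e :: real
  assumes i: "i > 0" and h: "h > 0" and e: "e > 0"
  shows "summable (\<lambda>n. (h * real n + i) powr (- (1 + e)))"
    and "i powr (- e) \<le> h * e * (\<Sum>n. (h * real n + i) powr (- (1 + e)))"
    and "h * e * (\<Sum>n. (h * real n + i) powr (- (1 + e))) \<le> i powr (- e) + h * e * i powr (- (1 + e))"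
proof -
  let ?a = "\<lambda>n. h * real n + i"
  have pos: "?a n > 0" for n using i h by (simp add: add_nonneg_pos)
  have "((\<lambda>n. ?a n powr (- e)) \<longlongrightarrow> 0) sequentially"
  proof (rule tendsto_neg_powr)
    show "filterlim ?a at_top sequentially"
      using filterlim_tendsto_add_at_top[OF tendsto_const[of i]
          filterlim_tendsto_pos_mult_at_top[OF tendsto_const h filterlim_real_sequentially]]
      by (simp add: add.commute)
  qed (use e in auto)
  from telescope_sums'[OF this]
  have tele: "(\<lambda>n. ?a n powr (- e) - ?a (Suc n) powr (- e)) sums (i powr (- e))"
    by simp
  have Suc: "?a (Suc n) = ?a n + h" for n by (simp add: algebra_simps)
  have lo: "h * e * ?a (Suc n) powr (- (1 + e)) \<le> ?a n powr (- e) - ?a (Suc n) powr (- e)" for n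
    unfolding Suc by (rule powr_step_bounds) (use pos e h in auto)
  have hi: "?a n powr (- e) - ?a (Suc n) powr (- e) \<le> h * e * ?a n powr (- (1 + e))" for n
    unfolding Suc by (rule powr_step_bounds) (use pos e h in auto)
  have "summable (\<lambda>n. h * e * ?a (Suc n) powr (- (1 + e)))"
    by (rule summable_comparison_test'[OF sums_summable[OF tele], of 0]) (use lo h e in auto)
  then have sS: "summable (\<lambda>n. h * e * ?a n powr (- (1 + e)))"
    using summable_Suc_iff[where f = "\<lambda>n. h * e * ?a n powr (- (1 + e))"] by blast
  then show summ: "summable (\<lambda>n. ?a n powr (- (1 + e)))"
    using h e by (subst (asm) summable_cmult_iff) auto
  have "i powr (- e) \<le> (\<Sum>n. h * e * ?a n powr (- (1 + e)))"
    using suminf_le[OF hi sums_summable[OF tele] sS] sums_unique[OF tele] by simp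
  then show "i powr (- e) \<le> h * e * (\<Sum>n. ?a n powr (- (1 + e)))"
    by (simp only: suminf_mult[OF summ])
  have "(\<Sum>n. h * e * ?a (Suc n) powr (- (1 + e))) \<le> i powr (- e)"
    using suminf_le[OF lo _ sums_summable[OF tele]] sums_unique[OF tele] sS
    summable_Suc_iff[where f = "\<lambda>n. h * e * ?a n powr (- (1 + e))"] by simp
  moreover have "(\<Sum>n. h * e * ?a (Suc n) powr (- (1 + e))) =
      (\<Sum>n. h * e * ?a n powr (- (1 + e))) - h * e * i powr (- (1 + e))"
    using suminf_split_head[OF sS] by simp
  ultimately show "h * e * (\<Sum>n. ?a n powr (- (1 + e))) \<le> i powr (- e) + h * e * i powr (- (1 + e))"
    by (simp only: suminf_mult[OF summ])
qed

text \<open>With \<open>e = 2 * (s - 1)\<close> the exponent \<open>- (1 + e)\<close> becomes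
  \<open>1 - 2 * s\<close>, and the factor \<open>h * e\<close> becomes
  \<open>2 * h * (s - 1)\<close>, whence the constant \<open>1 / (2 * h)\<close>.\<close>

lemma arithmetic_progression_zeta_limit:
  fixes i h :: real
  assumes i: "i > 0" and h: "h > 0"
  shows "((\<lambda>s. \<Sum>n. (s - 1) * (h * real n + i) powr (1 - 2 * s)) \<longlongrightarrow> 1 / (2 * h)) (at_right 1)"
proof -
  define Z where "Z s = (\<Sum>n. (s - 1) * (h * real n + i) powr (1 - 2 * s))" for s
  have Z: "i powr (- (2 * (s - 1))) / (2 * h) \<le> Z s"
    "Z s \<le> (i powr (- (2 * (s - 1))) + h * (2 * (s - 1)) * i powr (1 - 2 * s)) / (2 * h)" if s: "s > 1" for s
  proof -
    have *: "- (1 + 2 * (s - 1)) = 1 - 2 * s" by simp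
    note z = arithmetic_progression_zeta[OF i h, of "2 * (s - 1)", unfolded *]
    have eq: "Z s = (s - 1) * (\<Sum>n. (h * real n + i) powr (1 - 2 * s))"
      unfolding Z_def using z(1) s by (intro suminf_mult) auto
    show "i powr (- (2 * (s - 1))) / (2 * h) \<le> Z s"
      "Z s \<le> (i powr (- (2 * (s - 1))) + h * (2 * (s - 1)) * i powr (1 - 2 * s)) / (2 * h)"
      using z(2,3) s h unfolding eq by (auto simp: field_simps)
  qed
  have l1: "((\<lambda>s. i powr (- (2 * (s - 1))) / (2 * h)) \<longlongrightarrow> i powr (- (2 * (1 - 1))) / (2 * h)) (at_right 1)"
    using i h by (intro tendsto_intros) auto
  have l2: "((\<lambda>s. (i powr (- (2 * (s - 1))) + h * (2 * (s - 1)) * i powr (1 - 2 * s)) / (2 * h))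
    \<longlongrightarrow> (i powr (- (2 * (1 - 1))) + h * (2 * (1 - 1)) * i powr (1 - 2 * 1)) / (2 * h)) (at_right 1)"
    using i h by (intro tendsto_intros) auto
  have "(Z \<longlongrightarrow> 1 / (2 * h)) (at_right 1)"
  proof (rule tendsto_sandwich)
    show "\<forall>\<^sub>F s in at_right 1. i powr (- (2 * (s - 1))) / (2 * h) \<le> Z s"
      "\<forall>\<^sub>F s in at_right 1. Z s \<le> (i powr (- (2 * (s - 1))) + h * (2 * (s - 1)) * i powr (1 - 2 * s)) / (2 * h)"
      using eventually_at_right_less[of "1::real"] by (eventually_elim; use Z in blast)+
  qed (use l1 l2 i in auto)
  then show ?thesis by (simp add: Z_def[abs_def])
qed

lemma sum_int_telescope:
  fixes f :: "int \<Rightarrow> 'a::ab_group_add"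
  assumes "k \<le> l"
  shows "(\<Sum>i\<in>{k..<l}. f (i + 1) - f i) = f l - f k"
  using assms
proof (induction l rule: int_ge_induct)
  case (step l)
  then have "{k..<l + 1} = insert l {k..<l}" by auto
  then show ?case using step by simp
qed auto

text \<open>Points \<open>b / a\<close> with \<open>b\<close> in one class modulo 2 are spaced by
  \<open>2 / a\<close>, so the normalised sum is a Riemann sum for the whole integral. Allowing any
  \<open>B\<close> between the open and the closed interval makes the result insensitive to boundary
  points, whose contribution is of order \<open>1 / a\<close>.\<close>

lemma riemann_sum_parity:
  fixes g :: "real \<Rightarrow> real" and \<alpha> \<beta> \<epsilon> :: real and j :: int
  assumes \<alpha>\<beta>: "\<alpha> < \<beta>" and g: "continuous_on {\<alpha>..\<beta>} g" and j: "j \<in> {0, 1}" and \<epsilon>: "\<epsilon> > 0"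
  obtains A where "A > 0" "\<And>(a::real) B. a \<ge> A \<Longrightarrow>
     {b::int. b mod 2 = j \<and> \<alpha> * a < b \<and> b < \<beta> * a} \<subseteq> B \<Longrightarrow>
     B \<subseteq> {b. b mod 2 = j \<and> \<alpha> * a \<le> b \<and> b \<le> \<beta> * a} \<Longrightarrow>
     \<bar>2 / a * (\<Sum>b\<in>B. g (b / a)) - integral {\<alpha>..\<beta>} g\<bar> < \<epsilon>"
proof -
  \<comment> \<open>Each term of the sum is compared with an increment of this antiderivative by the
    mean value theorem.\<close>
  define G where "G x = integral {\<alpha>..x} g" for x
  have G': "(G has_real_derivative g t) (at t within {\<alpha>..\<beta>})" if "t \<in> {\<alpha>..\<beta>}" for t
    unfolding G_def by (rule integral_has_real_derivative[OF g that])
  have mvt: "\<exists>\<xi>\<in>{x..y}. G y - G x = (y - x) * g \<xi>" if "\<alpha> \<le> x" "x < y" "y \<le> \<beta>" for x y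
  proof -
    have "(G has_derivative (\<lambda>z. g t * z)) (at t within {x..y})" if t: "x \<le> t" "t \<le> y" for t
    proof -
      have "t \<in> {\<alpha>..\<beta>}" using t \<open>\<alpha> \<le> x\<close> \<open>y \<le> \<beta>\<close> by simp
      from G'[OF this] have "(G has_derivative (\<lambda>z. g t * z)) (at t within {\<alpha>..\<beta>})"
        by (simp only: has_field_derivative_def)
      then show ?thesis
        by (rule has_derivative_subset) (use \<open>\<alpha> \<le> x\<close> \<open>y \<le> \<beta>\<close> in simp)
    qed
    from mvt_simple[OF that(2) this] obtain \<xi> where "\<xi> \<in> {x<..<y}" "G y - G x = g \<xi> * (y - x)"
      by blast
    then show ?thesis by (intro bexI[of _ \<xi>]) (auto simp: mult.commute)
  qed
  obtain M where M: "M > 0" "\<And>t. t \<in> {\<alpha>..\<beta>} \<Longrightarrow> \<bar>g t\<bar> \<le> M"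
    using compact_imp_bounded[OF compact_continuous_image[OF g compact_Icc]]
    by (auto simp: bounded_pos)
  define \<epsilon>' where "\<epsilon>' = \<epsilon> / (2 * (\<beta> - \<alpha>))"
  have \<epsilon>': "\<epsilon>' > 0" using \<epsilon> \<alpha>\<beta> by (simp add: \<epsilon>'_def)
  obtain \<delta> where \<delta>: "\<delta> > 0"
    "\<And>s t. s \<in> {\<alpha>..\<beta>} \<Longrightarrow> t \<in> {\<alpha>..\<beta>} \<Longrightarrow> \<bar>t - s\<bar> < \<delta> \<Longrightarrow> \<bar>g t - g s\<bar> < \<epsilon>'"
    using compact_uniformly_continuous[OF g compact_Icc] \<epsilon>'
    unfolding uniformly_continuous_on_def dist_real_def by metis
  \<comment> \<open>In turn these bounds give \<open>1 \<le> a\<close>, spacing \<open>2 / a\<close>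
    below \<delta>, an interval long enough for \<open>k0 \<le> k1\<close>, and boundary errors
    totalling at most \<open>10 * (M / a) < \<epsilon> / 2\<close>.\<close>
  define A where "A = max (max 1 (3 / \<delta>)) (max (2 / (\<beta> - \<alpha>)) (24 * M / \<epsilon>))"
  show ?thesis
  proof (rule that[of A])
    show "A > 0" by (simp add: A_def)
    fix a :: real and B :: "int set"
    assume a: "a \<ge> A" and B1: "{b::int. b mod 2 = j \<and> \<alpha> * a < b \<and> b < \<beta> * a} \<subseteq> B"
      and B2: "B \<subseteq> {b. b mod 2 = j \<and> \<alpha> * a \<le> b \<and> b \<le> \<beta> * a}"
    have a1: "a \<ge> 1" and a2: "3 / \<delta> \<le> a" and a3: "2 / (\<beta> - \<alpha>) \<le> a" and a4: "24 * M / \<epsilon> \<le> a"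
      using a by (auto simp: A_def)
    have a0: "a > 0" using a1 by simp
    have d: "2 / a < \<delta>" using a2 \<delta>(1) a0 by (simp add: field_simps)
    have ab2: "2 \<le> \<beta> * a - \<alpha> * a" using a3 \<alpha>\<beta> by (simp add: field_simps)
    have aM: "M / a \<le> \<epsilon> / 24" using a4 \<epsilon> a0 by (simp add: field_simps)
    define k0 where "k0 = \<lceil>(\<alpha> * a - j) / 2\<rceil>"
    define k1 where "k1 = \<lfloor>(\<beta> * a - j) / 2\<rfloor>"
    have k0: "\<alpha> * a \<le> 2 * k0 + j" "2 * k0 + j < \<alpha> * a + 2"
      using ceiling_correct[of "(\<alpha> * a - j) / 2"] unfolding k0_def[symmetric] by auto
    have k1: "2 * k1 + j \<le> \<beta> * a" "\<beta> * a - 2 < 2 * k1 + j"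
      using floor_correct[of "(\<beta> * a - j) / 2"] unfolding k1_def[symmetric] by auto
    have k01: "k0 \<le> k1"
    proof -
      have "real_of_int (2 * k0) < 2 * k1 + 2" using k0 k1 ab2 by linarith
      then show ?thesis by linarith
    qed
    define b where "b k = 2 * k + j" for k
    define x where "x k = real_of_int (b k) / a" for k
    have x_range: "x k \<in> {\<alpha>..\<beta>}" if "k0 \<le> k" "k \<le> k1" for k
    proof -
      have "real_of_int k0 \<le> k" "real_of_int k \<le> k1" using that by auto
      then have "\<alpha> * a \<le> real_of_int (b k)" "real_of_int (b k) \<le> \<beta> * a"
        using k0 k1 by (auto simp: b_def)
      then show ?thesis using a0 by (simp add: x_def field_simps)
    qed
    have step: "\<bar>2 / a * g (x k) - (G (x (k + 1)) - G (x k))\<bar> \<le> 2 / a * \<epsilon>'" if k: "k \<in> {k0..<k1}" for k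
    proof -
      have x1: "x (k + 1) = x k + 2 / a" using a0 by (simp add: x_def b_def field_simps)
      have r: "x k \<in> {\<alpha>..\<beta>}" "x (k + 1) \<in> {\<alpha>..\<beta>}"
        using k by (auto intro!: x_range simp del: atLeastAtMost_iff)
      obtain \<xi> where \<xi>: "\<xi> \<in> {x k..x (k + 1)}" "G (x (k + 1)) - G (x k) = 2 / a * g \<xi>"
        using mvt[of "x k" "x (k + 1)"] r x1 a0 by auto
      have "\<bar>\<xi> - x k\<bar> < \<delta>" using \<xi>(1) d x1 by auto
      then have "\<bar>g \<xi> - g (x k)\<bar> < \<epsilon>'"
        using \<xi>(1) r by (intro \<delta>) auto
      moreover have "2 / a * g (x k) - (G (x (k + 1)) - G (x k)) = 2 / a * (g (x k) - g \<xi>)"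
        unfolding \<xi>(2) by (simp add: algebra_simps)
      ultimately show ?thesis using a0 by (simp add: abs_mult abs_minus_commute divide_right_mono)
    qed
    have main: "\<bar>2 / a * (\<Sum>k\<in>{k0..<k1}. g (x k)) - (G (x k1) - G (x k0))\<bar> \<le> \<epsilon> / 2"
    proof -
      have "2 / a * (\<Sum>k\<in>{k0..<k1}. g (x k)) - (G (x k1) - G (x k0)) =
          (\<Sum>k\<in>{k0..<k1}. 2 / a * g (x k) - (G (x (k + 1)) - G (x k)))"
        using sum_int_telescope[OF k01, of "\<lambda>k. G (x k)"] by (simp add: sum_subtractf sum_distrib_left)
      also have "\<bar>\<dots>\<bar> \<le> (\<Sum>k\<in>{k0..<k1}. 2 / a * \<epsilon>')"
        by (intro order_trans[OF sum_abs] sum_mono step)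
      also have "\<dots> = (2 * k1 - 2 * k0) / a * \<epsilon>'" using k01 by simp
      also have "\<dots> \<le> (\<beta> - \<alpha>) * \<epsilon>'"
        using k0 k1 a0 \<epsilon>' by (intro mult_right_mono) (auto simp: field_simps)
      also have "\<dots> = \<epsilon> / 2" using \<alpha>\<beta> by (simp add: \<epsilon>'_def field_simps)
      finally show ?thesis .
    qed
    have Glip: "\<bar>G v - G u\<bar> \<le> M * (v - u)" if uv: "\<alpha> \<le> u" "u \<le> v" "v \<le> \<beta>" for u v
    proof (cases "u = v")
      case False
      then obtain \<xi> where \<xi>: "\<xi> \<in> {u..v}" "G v - G u = (v - u) * g \<xi>" using mvt[of u v] uv by auto
      have "\<bar>g \<xi>\<bar> \<le> M" using \<xi>(1) uv by (intro M) auto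
      then show ?thesis using uv unfolding \<xi>(2) by (simp add: abs_mult mult.commute mult_right_mono)
    qed auto
    have ends: "x k0 - \<alpha> \<le> 2 / a" "\<beta> - x k1 \<le> 2 / a"
      using k0 k1 a0 by (auto simp: x_def b_def pos_le_divide_eq left_diff_distrib)
    have e0: "\<bar>G (x k0) - G \<alpha>\<bar> \<le> M * (2 / a)"
      using order_trans[OF Glip[of \<alpha> "x k0"] mult_left_mono[OF ends(1)]] x_range[of k0] k01 M(1) by auto
    have e1: "\<bar>G \<beta> - G (x k1)\<bar> \<le> M * (2 / a)"
      using order_trans[OF Glip[of "x k1" \<beta>] mult_left_mono[OF ends(2)]] x_range[of k1] k01 M(1) by auto
    have G: "G \<alpha> = 0" "G \<beta> = integral {\<alpha>..\<beta>} g" by (auto simp: G_def)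
    define I where "I = {b. b mod 2 = j \<and> \<alpha> * a \<le> real_of_int b \<and> real_of_int b \<le> \<beta> * a}"
    have I: "I = b ` {k0..k1}"
    proof (intro equalityI subsetI)
      fix c assume c: "c \<in> I"
      define k where "k = (c - j) div 2"
      have "c mod 2 = j" "j = 0 \<or> j = 1" using c j by (auto simp: I_def)
      then have ck: "c = b k" unfolding b_def k_def by presburger
      have "(\<alpha> * a - j) / 2 \<le> k" "k \<le> (\<beta> * a - j) / 2" using c by (auto simp: I_def ck b_def)
      then show "c \<in> b ` {k0..k1}" unfolding ck by (auto simp: k0_def k1_def ceiling_le_iff le_floor_iff)
    next
      fix c assume "c \<in> b ` {k0..k1}"
      then obtain k where k: "c = b k" "k0 \<le> k" "k \<le> k1" by auto
      have "x k \<in> {\<alpha>..\<beta>}" by (rule x_range[OF k(2,3)])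
      then show "c \<in> I" using a0 j unfolding I_def k(1) by (auto simp: x_def b_def field_simps)
    qed
    have fI: "finite I" unfolding I by simp
    have "(\<Sum>c\<in>I. g (c / a)) = (\<Sum>k\<in>{k0..k1}. g (x k))"
      unfolding I x_def by (subst sum.reindex) (auto simp: inj_on_def b_def)
    also have "{k0..k1} = insert k1 {k0..<k1}" using k01 by auto
    finally have sumI: "(\<Sum>c\<in>I. g (c / a)) = g (x k1) + (\<Sum>k\<in>{k0..<k1}. g (x k))" by simp
    \<comment> \<open>A point of the closed range missing from \<open>B\<close> is an integer equal
      to an endpoint, hence to the floor of that endpoint.\<close>
    have BI: "B \<subseteq> I" "I - B \<subseteq> {\<lfloor>\<alpha> * a\<rfloor>, \<lfloor>\<beta> * a\<rfloor>}"
    proof -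
      show "B \<subseteq> I" using B2 by (simp add: I_def)
      show "I - B \<subseteq> {\<lfloor>\<alpha> * a\<rfloor>, \<lfloor>\<beta> * a\<rfloor>}"
      proof
        fix c assume c: "c \<in> I - B"
        then have "\<not> (\<alpha> * a < c \<and> c < \<beta> * a)" "\<alpha> * a \<le> c" "c \<le> \<beta> * a"
          using B1 by (auto simp: I_def)
        then have "\<alpha> * a = c \<or> \<beta> * a = c" by auto
        then show "c \<in> {\<lfloor>\<alpha> * a\<rfloor>, \<lfloor>\<beta> * a\<rfloor>}" by auto
      qed
    qed
    have gI: "\<bar>g (c / a)\<bar> \<le> M" if "c \<in> I" for c
      using that a0 by (intro M) (auto simp: I_def field_simps)
    have "(\<Sum>c\<in>I. g (c / a)) - (\<Sum>c\<in>B. g (c / a)) = (\<Sum>c\<in>I - B. g (c / a))"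
      using sum_diff[OF fI BI(1), of "\<lambda>c. g (c / a)"] by simp
    also have "\<bar>\<dots>\<bar> \<le> (\<Sum>c\<in>I - B. M)"
      by (intro order_trans[OF sum_abs] sum_mono gI) auto
    also have "\<dots> \<le> 2 * M"
    proof -
      have "card (I - B) \<le> card {\<lfloor>\<alpha> * a\<rfloor>, \<lfloor>\<beta> * a\<rfloor>}" by (intro card_mono BI) auto
      also have "\<dots> \<le> 2" by (simp add: card_insert_if)
      finally show ?thesis using M(1) by simp
    qed
    finally have diff: "\<bar>(\<Sum>c\<in>I. g (c / a)) - (\<Sum>c\<in>B. g (c / a))\<bar> \<le> 2 * M" .
    have gk1: "\<bar>g (x k1)\<bar> \<le> M" using x_range[of k1] k01 by (intro M) auto
    define P where "P = (\<Sum>k\<in>{k0..<k1}. g (x k))"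
    define Q where "Q = (\<Sum>c\<in>B. g (c / a))"
    \<comment> \<open>One \<open>M\<close> pays for the last node \<open>x k1\<close>, which the
      left Riemann sum \<open>P\<close> omits, and two for the boundary points missing from
      \<open>B\<close>.\<close>
    have "\<bar>Q - P\<bar> \<le> 3 * M" using diff gk1 unfolding sumI P_def Q_def by linarith
    then have "2 / a * \<bar>Q - P\<bar> \<le> 2 / a * (3 * M)" using a0 by (intro mult_left_mono) auto
    moreover have "\<bar>2 / a * Q - 2 / a * P\<bar> = 2 / a * \<bar>Q - P\<bar>"
      using a0 abs_mult[of "2 / a" "Q - P"] by (simp add: right_diff_distrib diff_divide_distrib)
    ultimately have QP: "\<bar>2 / a * Q - 2 / a * P\<bar> \<le> 6 * (M / a)" by simp
    have "\<bar>2 / a * Q - integral {\<alpha>..\<beta>} g\<bar> \<le> 6 * (M / a) + \<epsilon> / 2 + 4 * (M / a)"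
    proof -
      have "M * (2 / a) = 2 * (M / a)" by simp
      then show ?thesis using main e0 e1 QP unfolding G P_def[symmetric] by linarith
    qed
    also have "\<dots> < \<epsilon>" using aM \<epsilon> by linarith
    finally show "\<bar>2 / a * (\<Sum>b\<in>B. g (b / a)) - integral {\<alpha>..\<beta>} g\<bar> < \<epsilon>" by (simp add: Q_def)
  qed
qed


section \<open>Simple pole of a homogeneous sum over a sector\<close>

text \<open>Summing over \<open>b\<close> first leaves \<open>a powr (1 - 2 * s)\<close> times a
  normalised Riemann sum, which at \<open>s = 1\<close> tends to half the integral of
  \<open>1 / f\<close>; the half comes from the parity of \<open>b\<close>. The parity of
  \<open>a\<close> gives the weights total mass 1/4. The limit is thus one eighth of a positive
  integral.\<close>

lemma cone_dirichlet_pole: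
  fixes f :: "real \<Rightarrow> real" and \<alpha> \<beta> :: real and C :: "(int \<times> int) set" and i j :: int
  assumes \<alpha>\<beta>: "\<alpha> < \<beta>" and f: "continuous_on {\<alpha>..\<beta>} f" and f_pos: "\<And>t. t \<in> {\<alpha>..\<beta>} \<Longrightarrow> f t > 0"
    and ij: "i \<in> {0, 1}" "j \<in> {0, 1}"
    and closed: "\<And>a b. (a, b) \<in> C \<Longrightarrow> a > 0 \<and> a mod 2 = i \<and> b mod 2 = j \<and> \<alpha> * a \<le> b \<and> b \<le> \<beta> * a"
    and interior: "\<And>a b. a > 0 \<Longrightarrow> a mod 2 = i \<Longrightarrow> b mod 2 = j \<Longrightarrow> \<alpha> * a < b \<Longrightarrow> b < \<beta> * a \<Longrightarrow> (a, b) \<in> C"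
  shows "dirichlet_pole 1 (\<lambda>(a, b). real_of_int a ^ 2 * f (b / a)) C"
proof -
  \<comment> \<open>The smallest positive member of the class; in the even class 0 is excluded by
    \<open>a > 0\<close>.\<close>
  define i' :: int where "i' = (if i = 0 then 2 else 1)"
  have i': "i' > 0" "i' mod 2 = i" using ij by (auto simp: i'_def)
  define a where "a n = 2 * int n + i'" for n
  have a_real: "real_of_int (a n) = 2 * real n + real_of_int i'" for n by (simp add: a_def)
  have a_pos: "a n > 0" for n using i' by (simp add: a_def)
  have a1: "real_of_int (a n) \<ge> 1" for n using a_pos[of n] by linarith
  have a_mod: "a n mod 2 = i" for n using i' by (simp add: a_def)
  define B where "B n = {b. (a n, b) \<in> C}" for n
  have B1: "{b. b mod 2 = j \<and> \<alpha> * a n < b \<and> b < \<beta> * a n} \<subseteq> B n" for n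
    using interior[OF a_pos a_mod] by (auto simp: B_def)
  have B2: "B n \<subseteq> {b. b mod 2 = j \<and> \<alpha> * a n \<le> b \<and> b \<le> \<beta> * a n}" for n
    using closed by (auto simp: B_def)
  have B_sub: "B n \<subseteq> {\<lceil>\<alpha> * a n\<rceil>..\<lfloor>\<beta> * a n\<rfloor>}" for n
    using B2[of n] by (auto simp: ceiling_le_iff le_floor_iff)
  have B_fin: "finite (B n)" for n using finite_subset[OF B_sub] by simp
  \<comment> \<open>At most \<open>(\<beta> - \<alpha>) * a + 1\<close> integers lie in the range,
    and \<open>1 \<le> a\<close> absorbs the final 1.\<close>
  define L where "L = \<beta> - \<alpha> + 1"
  have L: "L > 0" using \<alpha>\<beta> by (simp add: L_def)
  have B_card: "real (card (B n)) \<le> L * a n" for n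
  proof -
    have "card (B n) \<le> card {\<lceil>\<alpha> * a n\<rceil>..\<lfloor>\<beta> * a n\<rfloor>}" by (rule card_mono[OF _ B_sub]) simp
    then have "real (card (B n)) \<le> real (nat (\<lfloor>\<beta> * a n\<rfloor> + 1 - \<lceil>\<alpha> * a n\<rceil>))" by simp
    also have "\<dots> \<le> max 0 (\<beta> * a n - \<alpha> * a n + 1)" by linarith
    also have "\<dots> \<le> L * a n"
    proof -
      have "\<alpha> * a n \<le> \<beta> * a n" using a1[of n] \<alpha>\<beta> by (intro mult_right_mono) auto
      moreover have "L * a n = \<beta> * a n - \<alpha> * a n + a n" by (simp add: L_def algebra_simps)
      ultimately show ?thesis using a1[of n] by linarith
    qed
    finally show ?thesis .
  qed
  have in_range: "b / a n \<in> {\<alpha>..\<beta>}" if "b \<in> B n" for b n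
    using B2[of n] that a1[of n] by (auto simp: field_simps)
  have bij: "bij_betw (\<lambda>(n, b). (a n, b)) (Sigma UNIV B) C"
  proof (rule bij_betwI')
    fix z w :: "nat \<times> int"
    show "((case z of (n, b) \<Rightarrow> (a n, b)) = (case w of (n, b) \<Rightarrow> (a n, b))) = (z = w)"
      by (auto simp: a_def split: prod.splits)
  next
    fix y assume "y \<in> C"
    obtain c b where y: "y = (c, b)" by force
    have c: "c > 0" "c mod 2 = i" using closed \<open>y \<in> C\<close> y by auto
    have "c = a (nat ((c - i') div 2))"
      using c ij unfolding a_def i'_def by (auto split: if_splits) presburger+
    then show "\<exists>z\<in>Sigma UNIV B. y = (case z of (n, b) \<Rightarrow> (a n, b))"
      using \<open>y \<in> C\<close> unfolding y B_def by (intro bexI[of _ "(nat ((c - i') div 2), b)"]) auto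
  qed (auto simp: B_def)
  obtain t0 where t0: "t0 \<in> {\<alpha>..\<beta>}" "\<And>t. t \<in> {\<alpha>..\<beta>} \<Longrightarrow> f t0 \<le> f t"
    using continuous_attains_inf[OF compact_Icc _ f] \<alpha>\<beta> by auto
  obtain t1 where t1: "t1 \<in> {\<alpha>..\<beta>}" "\<And>t. t \<in> {\<alpha>..\<beta>} \<Longrightarrow> f t \<le> f t1"
    using continuous_attains_sup[OF compact_Icc _ f] \<alpha>\<beta> by auto
  have f0: "f t0 > 0" and f1: "f t1 > 0" using f_pos t0 t1 by auto
  define x where "x n s = (\<Sum>b\<in>B n. f (b / a n) powr (- s)) / a n" for n s
  have x_nonneg: "x n s \<ge> 0" for n s
    using a_pos[of n] by (auto simp: x_def intro!: divide_nonneg_pos sum_nonneg)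
  have avg: "\<bar>(\<Sum>b\<in>B n. h b) / a n\<bar> \<le> L * K" if "\<And>b. b \<in> B n \<Longrightarrow> \<bar>h b\<bar> \<le> K" "K \<ge> 0" for n K and h :: "int \<Rightarrow> real"
  proof -
    have "\<bar>\<Sum>b\<in>B n. h b\<bar> \<le> (\<Sum>b\<in>B n. K)"
      by (intro order_trans[OF sum_abs] sum_mono that)
    also have "\<dots> \<le> L * a n * K" using mult_right_mono[OF B_card that(2)] by simp
    finally show ?thesis using a1[of n] by (simp add: abs_div_pos[symmetric] field_simps)
  qed
  have x_le: "x n s \<le> L * f t0 powr (- s)" if "s > 1" for n s
  proof -
    have "\<bar>x n s\<bar> \<le> L * f t0 powr (- s)"
      unfolding x_def
    proof (rule avg)
      fix b assume "b \<in> B n"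
      then show "\<bar>f (b / a n) powr (- s)\<bar> \<le> f t0 powr (- s)"
        using f0 t0(2)[OF in_range] that by (auto intro!: powr_mono2')
    qed auto
    then show ?thesis by simp
  qed
  have inner: "(\<Sum>b\<in>B n. (real_of_int (a n) ^ 2 * f (b / a n)) powr (- s)) = real_of_int (a n) powr (1 - 2 * s) * x n s" for n s
  proof -
    have "(real_of_int (a n) ^ 2 * f (b / a n)) powr (- s) = real_of_int (a n) powr (- 2 * s) * f (b / a n) powr (- s)"
      if "b \<in> B n" for b
      using f_pos[OF in_range[OF that]] a_pos[of n]
      by (simp add: powr_mult powr_powr flip: powr_numeral)
    then have "(\<Sum>b\<in>B n. (real_of_int (a n) ^ 2 * f (b / a n)) powr (- s)) =
        real_of_int (a n) powr (- 2 * s) * (\<Sum>b\<in>B n. f (b / a n) powr (- s))"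
      by (simp add: sum_distrib_left)
    also have "\<dots> = real_of_int (a n) powr (1 + (- 2 * s)) * x n s"
      using a_pos[of n] unfolding x_def powr_add by simp
    finally show ?thesis by simp
  qed
  define W where "W n s = (s - 1) * real_of_int (a n) powr (1 - 2 * s)" for n s
  have summ_a: "summable (\<lambda>n. real_of_int (a n) powr (1 - 2 * s))" if "s > 1" for s
    using arithmetic_progression_zeta(1)[of "real_of_int i'" 2 "2 * (s - 1)"] i' that by (simp add: a_real)
  have W: "W n s \<ge> 0" "summable (\<lambda>n. W n s)" if "s > 1" for n s
    using that summ_a by (auto simp: W_def intro!: summable_mult)
  have summ_x: "summable (\<lambda>n. real_of_int (a n) powr (1 - 2 * s) * x n s)" if "s > 1" for s
  proof (rule summable_comparison_test'[where N = 0])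
    show "summable (\<lambda>n. real_of_int (a n) powr (1 - 2 * s) * (L * f t0 powr (- s)))"
      by (intro summable_mult2 summ_a that)
    show "norm (real_of_int (a n) powr (1 - 2 * s) * x n s) \<le> real_of_int (a n) powr (1 - 2 * s) * (L * f t0 powr (- s))" for n
      using x_nonneg[of n s] x_le[OF that, of n] by (auto simp: abs_mult intro!: mult_left_mono)
  qed
  let ?F = "\<lambda>(n, b). real_of_int (a n) ^ 2 * f (b / a n)"
  have hs: "((\<lambda>z. ?F z powr (- s)) has_sum (\<Sum>n. real_of_int (a n) powr (1 - 2 * s) * x n s)) (Sigma UNIV B)"
    if "s > 1" for s
  proof -
    have 1: "((\<lambda>b. ?F (n, b) powr (- s)) has_sum (real_of_int (a n) powr (1 - 2 * s) * x n s)) (B n)" for n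
      using has_sum_finite[OF B_fin[of n], of "\<lambda>b. ?F (n, b) powr (- s)"] by (simp add: inner)
    have 2: "((\<lambda>n. real_of_int (a n) powr (1 - 2 * s) * x n s) has_sum (\<Sum>n. real_of_int (a n) powr (1 - 2 * s) * x n s)) UNIV"
      using summ_x[OF that] x_nonneg by (intro norm_summable_imp_has_sum summable_sums) auto
    have 3: "(\<lambda>z. ?F z powr (- s)) summable_on Sigma UNIV B"
      by (rule summable_on_SigmaI[OF 1 has_sum_imp_summable[OF 2]]) auto
    show ?thesis by (rule has_sum_SigmaI[OF 1 2 3])
  qed
  define l where "l = integral {\<alpha>..\<beta>} (\<lambda>t. 1 / f t) / 2"
  have g_cont: "continuous_on {\<alpha>..\<beta>} (\<lambda>t. 1 / f t)"
    using f_pos by (intro continuous_intros f) force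
  have l_pos: "l > 0"
  proof -
    have "0 < (\<beta> - \<alpha>) * (1 / f t1)" using \<alpha>\<beta> f1 by simp
    also have "\<dots> = integral {\<alpha>..\<beta>} (\<lambda>_. 1 / f t1)" using \<alpha>\<beta> by simp
    also have "\<dots> \<le> integral {\<alpha>..\<beta>} (\<lambda>t. 1 / f t)"
      using t1(2) f_pos by (intro integral_le integrable_continuous_interval g_cont continuous_on_const) (auto intro!: divide_left_mono mult_pos_pos f1)
    finally show ?thesis by (simp add: l_def)
  qed
  have lim: "((\<lambda>s. \<Sum>n. W n s * x n s) \<longlongrightarrow> 1 / (2 * 2) * l) (at_right 1)"
  proof (rule tendsto_suminf_regular_weights)
    show "\<forall>\<^sub>F s in at_right 1. (\<forall>n. W n s \<ge> 0) \<and> summable (\<lambda>n. W n s)"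
      using eventually_at_right_less[of "1::real"] by eventually_elim (use W in auto)
    show "((\<lambda>s. \<Sum>n. W n s) \<longlongrightarrow> 1 / (2 * 2)) (at_right 1)"
      unfolding W_def a_real using i' by (intro arithmetic_progression_zeta_limit) auto
    show "(W n \<longlongrightarrow> 0) (at_right 1)" for n
    proof -
      have "((\<lambda>s. (s - 1) * real_of_int (a n) powr (1 - 2 * s)) \<longlongrightarrow> (1 - 1) * real_of_int (a n) powr (1 - 2 * 1)) (at_right 1)"
        using a_pos[of n] by (intro tendsto_intros) auto
      then show ?thesis by (simp add: W_def[abs_def])
    qed
    have p: "((\<lambda>s. f t0 powr (- s)) \<longlongrightarrow> f t0 powr (- 1)) (at_right 1)"
      using f0 by (intro tendsto_intros) auto
    have "\<forall>\<^sub>F s in at_right 1. f t0 powr (- s) < f t0 powr (- 1) + 1"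
      by (rule order_tendstoD(2)[OF p]) simp
    then show "\<forall>\<^sub>F s in at_right 1. \<forall>n. \<bar>x n s\<bar> \<le> L * (f t0 powr (- 1) + 1)"
      using eventually_at_right_less[of "1::real"]
    proof eventually_elim
      case (elim s)
      have "x n s \<le> L * (f t0 powr (- 1) + 1)" for n
        using order_trans[OF x_le[OF elim(2), of n] mult_left_mono[of "f t0 powr (- s)" "f t0 powr (- 1) + 1" L]] elim(1) L
        by simp
      then show ?case using x_nonneg by simp
    qed
    fix \<epsilon> :: real assume \<epsilon>: "\<epsilon> > 0"
    \<comment> \<open>Averaging over \<open>B n\<close> multiplies a termwise error by
      \<open>L\<close>, so \<eta> becomes \<open>\<epsilon> / 2\<close>.\<close>
    define \<eta> where "\<eta> = \<epsilon> / (2 * L)"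
    have \<eta>: "\<eta> > 0" using \<epsilon> L by (simp add: \<eta>_def)
    obtain A where A: "A > 0" "\<And>(a::real) B. a \<ge> A \<Longrightarrow>
     {b::int. b mod 2 = j \<and> \<alpha> * a < b \<and> b < \<beta> * a} \<subseteq> B \<Longrightarrow>
     B \<subseteq> {b. b mod 2 = j \<and> \<alpha> * a \<le> b \<and> b \<le> \<beta> * a} \<Longrightarrow>
     \<bar>2 / a * (\<Sum>b\<in>B. 1 / f (b / a)) - integral {\<alpha>..\<beta>} (\<lambda>t. 1 / f t)\<bar> < \<epsilon>"
      using riemann_sum_parity[OF \<alpha>\<beta> g_cont ij(2) \<epsilon>] by blast
    have x1: "\<bar>x n 1 - l\<bar> < \<epsilon> / 2" if "n \<ge> nat \<lceil>A\<rceil>" for n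
    proof -
      have "real_of_int (a n) \<ge> A" using that i'(1) by (simp add: a_def)
      from A(2)[OF this B1 B2] have "\<bar>2 / a n * (\<Sum>b\<in>B n. 1 / f (b / a n)) - 2 * l\<bar> < \<epsilon>"
        by (simp add: l_def)
      moreover have "(\<Sum>b\<in>B n. 1 / f (b / a n)) = (\<Sum>b\<in>B n. f (b / a n) powr (- 1))"
        using f_pos[OF in_range] by (intro sum.cong) (auto simp: powr_minus_divide abs_of_pos)
      ultimately have "\<bar>2 * x n 1 - 2 * l\<bar> < \<epsilon>" by (simp add: x_def)
      then show ?thesis by linarith
    qed
    \<comment> \<open>The Riemann sum is controlled at \<open>s = 1\<close> only. The passage to
      nearby \<open>s\<close> is uniform in \<open>n\<close>: the termwise error is
      \<open>|y powr (1 - s) - 1| / y\<close> with \<open>y\<close> between \<open>f t0\<close> and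
      \<open>f t1\<close>, and monotonicity in \<open>y\<close> reduces it to these two extreme
      values.\<close>
    have q0: "((\<lambda>s. f t0 powr (1 - s)) \<longlongrightarrow> f t0 powr (1 - 1)) (at_right 1)"
      and q1: "((\<lambda>s. f t1 powr (1 - s)) \<longlongrightarrow> f t1 powr (1 - 1)) (at_right 1)"
      using f0 f1 by (intro tendsto_intros; simp)+
    have "\<forall>\<^sub>F s in at_right 1. f t0 powr (1 - s) < 1 + \<eta> * f t0"
      "\<forall>\<^sub>F s in at_right 1. f t1 powr (1 - s) > 1 - \<eta> * f t0"
      using \<eta> f0 f1 by (intro order_tendstoD(2)[OF q0] order_tendstoD(1)[OF q1]; simp)+
    then have "\<forall>\<^sub>F s in at_right 1. \<forall>n\<ge>nat \<lceil>A\<rceil>. \<bar>x n s - l\<bar> < \<epsilon>"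
      using eventually_at_right_less[of "1::real"]
    proof eventually_elim
      case (elim s)
      have "\<bar>x n s - x n 1\<bar> \<le> \<epsilon> / 2" for n
      proof -
        have "\<bar>f (b / a n) powr (- s) - f (b / a n) powr (- 1)\<bar> \<le> \<eta>" if b: "b \<in> B n" for b
        proof -
          define y where "y = f (b / a n)"
          have y: "f t0 \<le> y" "y \<le> f t1" using t0(2) t1(2) in_range[OF b] by (auto simp: y_def)
          have "y powr (1 - s) \<le> f t0 powr (1 - s)" "f t1 powr (1 - s) \<le> y powr (1 - s)"
            using y f0 elim(3) by (auto intro!: powr_mono2')
          then have "\<bar>y powr (1 - s) - 1\<bar> \<le> \<eta> * f t0" using elim(1,2) by linarith
          also have "\<dots> \<le> \<eta> * y" using y \<eta> by simp
          finally have "\<bar>y powr (1 - s) - 1\<bar> / y \<le> \<eta>" using y f0 by (simp add: pos_divide_le_eq)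
          moreover have "y powr (- s) - y powr (- 1) = (y powr (1 - s) - 1) / y"
            using y f0 by (simp add: powr_diff powr_minus_divide field_simps)
          ultimately show ?thesis using y f0 by (simp add: y_def)
        qed
        then have "\<bar>(\<Sum>b\<in>B n. f (b / a n) powr (- s) - f (b / a n) powr (- 1)) / a n\<bar> \<le> L * \<eta>"
          using \<eta> by (intro avg) auto
        then show ?thesis using L by (simp add: x_def sum_subtractf diff_divide_distrib \<eta>_def)
      qed
      then show ?case using x1 by (smt (verit, best) field_sum_of_halves)
    qed
    then show "\<exists>N. \<forall>\<^sub>F s in at_right 1. \<forall>n\<ge>N. \<bar>x n s - l\<bar> < \<epsilon>" by blast
  qed
  have lim': "((\<lambda>s. (s - 1) ^ 1 * (\<Sum>\<^sub>\<infinity>z\<in>Sigma UNIV B. ?F z powr (- s))) \<longlongrightarrow> 1 / (2 * 2) * l) (at_right 1)"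
  proof (rule Lim_transform_eventually[OF lim])
    show "\<forall>\<^sub>F s in at_right 1. (\<Sum>n. W n s * x n s) = (s - 1) ^ 1 * (\<Sum>\<^sub>\<infinity>z\<in>Sigma UNIV B. ?F z powr (- s))"
      using eventually_at_right_less[of "1::real"]
      by eventually_elim (simp add: infsumI[OF hs] W_def mult.assoc suminf_mult[OF summ_x])
  qed
  have "\<forall>z\<in>Sigma UNIV B. ?F z > 0"
    using f_pos[OF in_range] a_pos by (auto intro!: mult_pos_pos simp: less_imp_neq[symmetric])
  moreover have "\<forall>s>1. (\<lambda>z. ?F z powr (- s)) summable_on Sigma UNIV B"
    using has_sum_imp_summable[OF hs] by blast
  moreover have "1 / (2 * 2) * l > 0" using l_pos by simp
  ultimately have "dirichlet_pole 1 ?F (Sigma UNIV B)"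
    using lim' unfolding dirichlet_pole_def by blast
  then show ?thesis
    by (rule dirichlet_pole_bij_betw[OF bij, rotated]) auto
qed

section \<open>Quadratic forms on sectors\<close>


lemma summable_on_odd_powers:
  assumes "s > 1 / 2"
  shows "(\<lambda>d. (real_of_int d ^ 2) powr (- s)) summable_on {d. odd d \<and> d > 0}"
proof -
  have bij: "bij_betw (\<lambda>n. 2 * int n + 1) UNIV {d. odd d \<and> d > 0}"
  proof (rule bij_betwI')
    fix d :: int assume "d \<in> {d. odd d \<and> d > 0}"
    then have "d = 2 * int (nat (d div 2)) + 1" by (auto elim!: oddE)
    then show "\<exists>n\<in>UNIV. d = 2 * int n + 1" by blast
  qed auto
  have "((2 * real n + 1) ^ 2) powr (- s) = (2 * real n + 1) powr (- (1 + (2 * s - 1)))" for n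
    by (simp add: powr_powr flip: powr_numeral)
  then have "summable (\<lambda>n. ((2 * real n + 1) ^ 2) powr (- s))"
    using arithmetic_progression_zeta(1)[of 1 2 "2 * s - 1"] assms by simp
  then have "(\<lambda>n. (real_of_int (2 * int n + 1) ^ 2) powr (- s)) summable_on UNIV"
    by (simp add: summable_on_UNIV_nonneg_real_iff)
  then show ?thesis
    using summable_on_reindex_bij_betw[OF bij, of "\<lambda>d. (real_of_int d ^ 2) powr (- s)"] by simp
qed

text \<open>Each pair is uniquely its gcd \<open>d\<close> times a coprime pair. Here
  \<open>d\<close> is odd because some coordinate is, odd multiples stay in the same parity class,
  and homogeneity of degree 2 turns scaling by \<open>d\<close> into the factor
  \<open>d^2\<close>.\<close>

lemma dirichlet_pole_coprime:
  fixes X :: "(int \<times> int) set" and F :: "int \<times> int \<Rightarrow> real"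
  assumes pole: "dirichlet_pole m F X"
    and scale: "\<And>d a b. odd d \<Longrightarrow> d > 0 \<Longrightarrow> (d * a, d * b) \<in> X \<longleftrightarrow> (a, b) \<in> X"
    and odd: "\<And>a b. (a, b) \<in> X \<Longrightarrow> odd a \<or> odd b"
    and hom: "\<And>d a b. (a, b) \<in> X \<Longrightarrow> d > 0 \<Longrightarrow> F (d * a, d * b) = real_of_int d ^ 2 * F (a, b)"
  shows "dirichlet_pole m F (X \<inter> {(a, b). coprime a b})"
proof -
  let ?O = "{d::int. odd d \<and> d > 0}" and ?Y = "X \<inter> {(a, b). coprime a b}"
  have bij: "bij_betw (\<lambda>(d, a, b). (d * a, d * b)) (?O \<times> ?Y) X"
  proof (rule bij_betwI')
    fix z w assume zw: "z \<in> ?O \<times> ?Y" "w \<in> ?O \<times> ?Y"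
    obtain d a b where z: "z = (d, a, b)" by (cases z) auto
    obtain d' a' b' where w: "w = (d', a', b')" by (cases w) auto
    have "d = d'" if "d * a = d' * a'" "d * b = d' * b'"
    proof -
      have "gcd (d * a) (d * b) = d" "gcd (d' * a') (d' * b') = d'"
        using zw unfolding z w by (simp_all add: gcd_mult_distrib_int[symmetric] coprime_iff_gcd_eq_1)
      then show ?thesis using that by simp
    qed
    then show "((case z of (d, a, b) \<Rightarrow> (d * a, d * b)) = (case w of (d, a, b) \<Rightarrow> (d * a, d * b))) = (z = w)"
      using zw unfolding z w by auto
  next
    fix y assume y: "y \<in> X"
    obtain a b where ab: "y = (a, b)" by force
    define d where "d = gcd a b"
    have "odd a \<or> odd b" using odd y ab by blast
    then have d: "odd d" "d > 0" using odd_one by (auto simp: d_def) 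
    have "gcd a b \<noteq> 0" using d by (simp add: d_def)
    from gcd_coprime_exists[OF this, folded d_def]
    obtain a' b' where "a = a' * d" "b = b' * d" "coprime a' b'" by blast
    then have ab': "a = d * a'" "b = d * b'" "coprime a' b'" by (simp_all only: mult.commute)
    have "(a', b') \<in> X" using scale[OF d, of a' b'] y ab ab' by simp
    then show "\<exists>z\<in>?O \<times> ?Y. y = (case z of (d, a, b) \<Rightarrow> (d * a, d * b))"
      using ab ab' d by (intro bexI[of _ "(d, a', b')"]) auto
  qed (use scale in auto)
  have "dirichlet_pole m (\<lambda>z. F (case z of (d, a, b) \<Rightarrow> (d * a, d * b))) (?O \<times> ?Y)"
    using pole dirichlet_pole_bij_betw_iff[OF bij] by blast
  then have "dirichlet_pole m (\<lambda>(d, y). real_of_int d ^ 2 * F y) (?O \<times> ?Y)"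
    by (subst (asm) dirichlet_pole_cong[where G = "\<lambda>(d, y). real_of_int d ^ 2 * F y"]) (auto simp: hom)
  then show ?thesis
  proof (rule dirichlet_pole_divide)
    show "?O \<noteq> {}" using odd_one[where 'a = int] zero_less_one by blast
  qed (auto intro: summable_on_odd_powers)
qed

text \<open>Half-open, so that the four quarter turns of the sector between slopes -1 and 1 tile the
  punctured plane. The ray \<open>a = b\<close> belongs to the sector from 1 to
  \<open>sqrt 3\<close> and yields the element 1 of \<open>S_set\<close>; rays of slope
  \<open>sqrt 3\<close> or \<open>1 / sqrt 3\<close> contain no integer point with
  \<open>a > 0\<close>.\<close>

definition sector :: "real \<Rightarrow> real \<Rightarrow> (int \<times> int) set" where
  "sector \<alpha> \<beta> = {(a, b). a > 0 \<and> \<alpha> * real_of_int a \<le> real_of_int b \<and> real_of_int b < \<beta> * real_of_int a}"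

lemma sector_scale: "d > 0 \<Longrightarrow> (d * a, d * b) \<in> sector \<alpha> \<beta> \<longleftrightarrow> (a, b) \<in> sector \<alpha> \<beta>"
proof -
  assume d: "d > 0"
  have "\<alpha> * real_of_int (d * a) = d * (\<alpha> * a)" "\<beta> * real_of_int (d * a) = d * (\<beta> * a)" by simp_all
  then show ?thesis using d by (simp add: sector_def zero_less_mult_iff)
qed

context
  fixes \<alpha> \<beta> :: real and f :: "real \<Rightarrow> real" and F :: "int \<times> int \<Rightarrow> real"
  assumes \<alpha>\<beta>: "\<alpha> < \<beta>" and f: "continuous_on {\<alpha>..\<beta>} f" "\<And>t. t \<in> {\<alpha>..\<beta>} \<Longrightarrow> f t > 0"
    and F: "\<And>a b. a > 0 \<Longrightarrow> F (a, b) = real_of_int a ^ 2 * f (b / a)"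
begin

lemma sector_class_pole:
  assumes "i \<in> {0, 1}" "j \<in> {0, 1}"
  shows "dirichlet_pole 1 F (sector \<alpha> \<beta> \<inter> {(a, b). a mod 2 = i \<and> b mod 2 = j})"
proof -
  have "dirichlet_pole 1 (\<lambda>(a, b). real_of_int a ^ 2 * f (b / a)) (sector \<alpha> \<beta> \<inter> {(a, b). a mod 2 = i \<and> b mod 2 = j})"
    by (rule cone_dirichlet_pole[OF \<alpha>\<beta> f assms]) (auto simp: sector_def)
  then show ?thesis
    by (rule dirichlet_pole_cong[THEN iffD1, rotated]) (auto simp: sector_def F)
qed

lemma sector_even_pole: "dirichlet_pole 1 F (sector \<alpha> \<beta> \<inter> {(a, b). even a \<and> even b})"
  using sector_class_pole[of 0 0] by (simp add: even_iff_mod_2_eq_zero)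

lemma sector_odd_pole: "dirichlet_pole 1 F (sector \<alpha> \<beta> \<inter> {(a, b). odd a \<and> odd b})"
  using sector_class_pole[of 1 1] by (simp add: odd_iff_mod_2_eq_one)

lemma sector_same_parity_pole: "dirichlet_pole 1 F (sector \<alpha> \<beta> \<inter> {(a, b). even a \<longleftrightarrow> even b})"
proof -
  have "sector \<alpha> \<beta> \<inter> {(a, b). even a \<longleftrightarrow> even b} =
      (sector \<alpha> \<beta> \<inter> {(a, b). even a \<and> even b}) \<union> (sector \<alpha> \<beta> \<inter> {(a, b). odd a \<and> odd b})" by auto
  moreover have "dirichlet_pole 1 F \<dots>"
    by (rule dirichlet_pole_Un[OF sector_even_pole sector_odd_pole]) auto
  ultimately show ?thesis by simp
qed

lemma sector_opposite_parity_pole: "dirichlet_pole 1 F (sector \<alpha> \<beta> \<inter> {(a, b). even a \<longleftrightarrow> odd b})"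
proof -
  have "sector \<alpha> \<beta> \<inter> {(a, b). even a \<longleftrightarrow> odd b} =
      (sector \<alpha> \<beta> \<inter> {(a, b). a mod 2 = 0 \<and> b mod 2 = 1}) \<union> (sector \<alpha> \<beta> \<inter> {(a, b). a mod 2 = 1 \<and> b mod 2 = 0})"
    by (auto simp: even_iff_mod_2_eq_zero)
  moreover have "dirichlet_pole 1 F \<dots>"
    by (rule dirichlet_pole_Un; (rule sector_class_pole)?) auto
  ultimately show ?thesis by simp
qed

lemma sector_homogeneous:
  "(a, b) \<in> sector \<alpha> \<beta> \<Longrightarrow> d > 0 \<Longrightarrow> F (d * a, d * b) = real_of_int d ^ 2 * F (a, b)"
  by (auto simp: sector_def F power_mult_distrib)

lemma sector_coprime_odd_pole:
  "dirichlet_pole 1 F (sector \<alpha> \<beta> \<inter> {(a, b). odd a \<and> odd b} \<inter> {(a, b). coprime a b})"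
  by (rule dirichlet_pole_coprime[OF sector_odd_pole]) (auto simp: sector_scale sector_homogeneous)

lemma sector_coprime_opposite_parity_pole:
  "dirichlet_pole 1 F (sector \<alpha> \<beta> \<inter> {(a, b). even a \<longleftrightarrow> odd b} \<inter> {(a, b). coprime a b})"
  by (rule dirichlet_pole_coprime[OF sector_opposite_parity_pole]) (auto simp: sector_scale sector_homogeneous)

end

lemmas sector_quadratic_poles =
  sector_even_pole sector_same_parity_pole sector_coprime_odd_pole sector_coprime_opposite_parity_pole

text \<open>Here \<open>f t = c * t\<close>, positive because the sector starts at a positive
  slope.\<close>

lemma sector_product_coprime_poles:
  fixes c :: real
  assumes "0 < \<alpha>" "\<alpha> < \<beta>" "0 < c"
  shows "dirichlet_pole 1 (\<lambda>(a, b). c * real_of_int (a * b)) (sector \<alpha> \<beta> \<inter> {(a, b). odd a \<and> odd b} \<inter> {(a, b). coprime a b})"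
    and "dirichlet_pole 1 (\<lambda>(a, b). c * real_of_int (a * b)) (sector \<alpha> \<beta> \<inter> {(a, b). even a \<longleftrightarrow> odd b} \<inter> {(a, b). coprime a b})"
proof -
  have 1: "continuous_on {\<alpha>..\<beta>} (\<lambda>t. c * t)" by (intro continuous_intros)
  have 2: "(case (a, b) of (a, b) \<Rightarrow> c * real_of_int (a * b)) = real_of_int a ^ 2 * (c * (b / a))" if "a > 0" for a b :: int
    using that by (simp add: power2_eq_square)
  show "dirichlet_pole 1 (\<lambda>(a, b). c * real_of_int (a * b)) (sector \<alpha> \<beta> \<inter> {(a, b). odd a \<and> odd b} \<inter> {(a, b). coprime a b})"
    "dirichlet_pole 1 (\<lambda>(a, b). c * real_of_int (a * b)) (sector \<alpha> \<beta> \<inter> {(a, b). even a \<longleftrightarrow> odd b} \<inter> {(a, b). coprime a b})"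
    by (rule sector_quadratic_poles[OF assms(2) 1 _ 2]; use assms in auto)+
qed

text \<open>Here \<open>f t = c * (1 + t^2)\<close>, positive at every slope; sectors reaching below
  the axis are therefore covered, as the one for \<open>z\<close> requires.\<close>

lemma sector_norm_poles:
  fixes c :: real
  assumes "\<alpha> < \<beta>" "0 < c"
  shows "dirichlet_pole 1 (\<lambda>(a, b). c * real_of_int (a ^ 2 + b ^ 2)) (sector \<alpha> \<beta> \<inter> {(a, b). even a \<and> even b})"
    and "dirichlet_pole 1 (\<lambda>(a, b). c * real_of_int (a ^ 2 + b ^ 2)) (sector \<alpha> \<beta> \<inter> {(a, b). even a \<longleftrightarrow> even b})"
    and "dirichlet_pole 1 (\<lambda>(a, b). c * real_of_int (a ^ 2 + b ^ 2)) (sector \<alpha> \<beta> \<inter> {(a, b). odd a \<and> odd b} \<inter> {(a, b). coprime a b})"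
    and "dirichlet_pole 1 (\<lambda>(a, b). c * real_of_int (a ^ 2 + b ^ 2)) (sector \<alpha> \<beta> \<inter> {(a, b). even a \<longleftrightarrow> odd b} \<inter> {(a, b). coprime a b})"
proof -
  have 1: "continuous_on {\<alpha>..\<beta>} (\<lambda>t. c * (1 + t ^ 2))" by (intro continuous_intros)
  have 2: "(case (a, b) of (a, b) \<Rightarrow> c * real_of_int (a ^ 2 + b ^ 2)) = real_of_int a ^ 2 * (c * (1 + (b / a) ^ 2))" if "a > 0" for a b :: int
    using that by (simp add: field_simps)
  have 3: "c * (1 + t ^ 2) > 0" for t :: real using assms by (simp add: add_pos_nonneg)
  show "dirichlet_pole 1 (\<lambda>(a, b). c * real_of_int (a ^ 2 + b ^ 2)) (sector \<alpha> \<beta> \<inter> {(a, b). even a \<and> even b})"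
    "dirichlet_pole 1 (\<lambda>(a, b). c * real_of_int (a ^ 2 + b ^ 2)) (sector \<alpha> \<beta> \<inter> {(a, b). even a \<longleftrightarrow> even b})"
    "dirichlet_pole 1 (\<lambda>(a, b). c * real_of_int (a ^ 2 + b ^ 2)) (sector \<alpha> \<beta> \<inter> {(a, b). odd a \<and> odd b} \<inter> {(a, b). coprime a b})"
    "dirichlet_pole 1 (\<lambda>(a, b). c * real_of_int (a ^ 2 + b ^ 2)) (sector \<alpha> \<beta> \<inter> {(a, b). even a \<longleftrightarrow> odd b} \<inter> {(a, b). coprime a b})"
    by (rule sector_quadratic_poles[OF assms(1) 1 3 2]; assumption)+
qed

section \<open>Pythagorean fractions\<close>


lemma less_sqrt3_mult_iff:
  fixes a b :: int
  assumes "0 < a" "0 \<le> b"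
  shows "real_of_int b < sqrt 3 * real_of_int a \<longleftrightarrow> b ^ 2 < 3 * a ^ 2"
proof -
  have "sqrt 3 * real_of_int a = sqrt (real_of_int (3 * a ^ 2))" "real_of_int b = sqrt (real_of_int (b ^ 2))"
    using assms by (simp_all add: real_sqrt_mult)
  then show ?thesis by (simp only: real_sqrt_less_iff of_int_less_iff)
qed

lemma sector_1_sqrt3_iff: "(a, b) \<in> sector 1 (sqrt 3) \<longleftrightarrow> 0 < a \<and> a \<le> b \<and> b ^ 2 < 3 * a ^ 2"
  using less_sqrt3_mult_iff[of a b] by (auto simp: sector_def)

text \<open>Squaring removes \<open>sqrt 3\<close> and the quotient, and \<open>p < q\<close> makes
  the truncated subtraction in \<open>q^2 - p^2\<close> exact.\<close>

lemma S_set_iff: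
  "(p, q) \<in> S_set \<longleftrightarrow> p = 1 \<and> q = 1 \<or>
     p < q \<and> coprime p q \<and> 3 * q ^ 2 < 4 * p ^ 2 \<and> (\<exists>k. p ^ 2 + k ^ 2 = q ^ 2)"
proof -
  have "sqrt 3 / 2 < real p / real q \<longleftrightarrow> 3 * q ^ 2 < 4 * p ^ 2" if "0 < q"
  proof -
    have "sqrt 3 / 2 < real p / real q \<longleftrightarrow> sqrt 3 * real q < 2 * real p"
      using that by (simp add: field_simps)
    also have "\<dots> \<longleftrightarrow> sqrt (real (3 * q ^ 2)) < sqrt (real (4 * p ^ 2))"
      by (simp add: real_sqrt_mult)
    also have "\<dots> \<longleftrightarrow> 3 * q ^ 2 < 4 * p ^ 2" by (simp only: real_sqrt_less_iff of_nat_less_iff)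
    finally show ?thesis .
  qed
  moreover have "(\<exists>k. k ^ 2 = q ^ 2 - p ^ 2) \<longleftrightarrow> (\<exists>k. p ^ 2 + k ^ 2 = q ^ 2)" if "p < q"
  proof -
    have "p ^ 2 \<le> q ^ 2" using that by (simp add: power_mono)
    then show ?thesis by (metis add_diff_cancel_left' le_add_diff_inverse)
  qed
  ultimately show ?thesis by (auto simp: S_set_def)
qed

text \<open>With $k^2 = q^2 - p^2$ one has $q + k = c\,b^2$ and $q - k = c\,a^2$.\<close>
definition pyth_scale :: "int \<times> int \<Rightarrow> int" where
  "pyth_scale = (\<lambda>(a, b). if odd a \<and> odd b then 1 else 2)"

text \<open>For coprime \<open>a\<close>, \<open>b\<close> these are the two shapes of Euclid's
  parametrisation of primitive Pythagorean triples: odd \<open>p\<close> from odd \<open>a\<close>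
  and \<open>b\<close>, even \<open>p\<close> from opposite parities. The division by 2 is exact in
  both.\<close>

definition pyth_pair :: "int \<times> int \<Rightarrow> nat \<times> nat" where
  "pyth_pair = (\<lambda>(a, b). (nat (pyth_scale (a, b) * (a * b)), nat (pyth_scale (a, b) * (a ^ 2 + b ^ 2) div 2)))"

lemma pyth_pair_eqs:
  assumes "0 < a" "a \<le> b" "pyth_pair (a, b) = (p, q)"
  obtains k where "k \<ge> 0" "int p = pyth_scale (a, b) * (a * b)" "int q + k = pyth_scale (a, b) * b ^ 2"
    "int q - k = pyth_scale (a, b) * a ^ 2" "int p ^ 2 + k ^ 2 = int q ^ 2"
proof -
  define c where "c = pyth_scale (a, b)"
  have c: "c > 0" by (simp add: c_def pyth_scale_def)
  have "even (c * (a ^ 2 + b ^ 2))" by (auto simp: c_def pyth_scale_def)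
  moreover have "int p = c * (a * b)" "int q = c * (a ^ 2 + b ^ 2) div 2"
    using assms c by (auto simp: pyth_pair_def c_def)
  ultimately have pq: "int p = c * (a * b)" "2 * int q = c * (a ^ 2 + b ^ 2)" by simp_all
  define k where "k = int q - c * a ^ 2"
  have "2 * k = c * (b ^ 2 - a ^ 2)" using pq(2) by (simp add: k_def algebra_simps)
  moreover have "a ^ 2 \<le> b ^ 2" using assms by (simp add: power_mono)
  then have "0 \<le> c * (b ^ 2 - a ^ 2)" using c by simp
  ultimately have "k \<ge> 0" by linarith
  moreover have eqs: "int q + k = c * b ^ 2" "int q - k = c * a ^ 2"
    using pq(2) by (simp_all add: k_def algebra_simps)
  moreover have "int p ^ 2 + k ^ 2 = int q ^ 2"
  proof -
    have "int q ^ 2 - k ^ 2 = (int q - k) * (int q + k)" by (simp add: power2_eq_square algebra_simps)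
    also have "\<dots> = int p ^ 2" unfolding eqs pq(1) by (simp add: power2_eq_square)
    finally show ?thesis by simp
  qed
  ultimately show ?thesis using that pq(1) unfolding c_def by blast
qed

text \<open>In terms of the second leg \<open>k\<close>, the bound \<open>b^2 < 3 * a^2\<close> says
  \<open>q + k < 3 * (q - k)\<close>, that is \<open>2 * k < q\<close>. Squaring gives
  \<open>4 * (q^2 - p^2) < q^2\<close>, the condition on \<open>p / q\<close>.\<close>

lemma pyth_pair_in_S_set:
  assumes "0 < a" "a \<le> b" "b ^ 2 < 3 * a ^ 2" "coprime a b"
  shows "pyth_pair (a, b) \<in> S_set"
proof (cases "a = b")
  case True
  then show ?thesis using assms by (auto simp: pyth_pair_def pyth_scale_def S_set_def)
next
  case False
  define c where "c = pyth_scale (a, b)"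
  obtain p q where pq: "pyth_pair (a, b) = (p, q)" by force
  obtain k where k: "k \<ge> 0" "int p = c * (a * b)" "int q + k = c * b ^ 2"
    "int q - k = c * a ^ 2" "int p ^ 2 + k ^ 2 = int q ^ 2"
    using pyth_pair_eqs[OF assms(1,2) pq] unfolding c_def by metis
  have c: "c > 0" by (simp add: c_def pyth_scale_def)
  have "c * a ^ 2 < c * b ^ 2" using False assms c by (simp add: power_strict_mono)
  then have k0: "k > 0" using k by linarith
  have "c * b ^ 2 < c * (3 * a ^ 2)" using assms c by simp
  then have qk: "2 * k < int q" using k by linarith
  have "(2 * k) ^ 2 < int q ^ 2" using qk k0 by (intro power_strict_mono) auto
  then have "3 * int q ^ 2 < 4 * int p ^ 2" using k(5) by (simp add: power_mult_distrib)
  then have "int (3 * q ^ 2) < int (4 * p ^ 2)" by simp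
  then have 1: "3 * q ^ 2 < 4 * p ^ 2" by (simp only: of_nat_less_iff)
  have "int p ^ 2 < int q ^ 2" using k(5) k0 by (smt (verit) zero_less_power)
  then have 2: "p < q" using power2_less_imp_less by fastforce
  have "int (p ^ 2 + nat k ^ 2) = int (q ^ 2)" using k by simp
  then have 3: "p ^ 2 + nat k ^ 2 = q ^ 2" by (simp only: of_nat_eq_iff)
  \<comment> \<open>A common prime factor would divide both \<open>a\<close> and \<open>b\<close>.
    Only the factor 2 that \<open>p\<close> may carry then needs care; it is harmless because
    \<open>q\<close> is odd when the parities differ.\<close>
  have cop: "coprime (a * b) (a ^ 2 + b ^ 2)"
  proof -
    have "coprime a (a * a + b ^ 2)"
      unfolding coprime_iff_gcd_eq_1 gcd_add_mult using assms(4) by simp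
    moreover have "coprime b (b * b + a ^ 2)"
      unfolding coprime_iff_gcd_eq_1 gcd_add_mult using assms(4) by (simp add: coprime_commute)
    ultimately show ?thesis by (simp add: power2_eq_square add.commute)
  qed
  have twoq: "2 * int q = c * (a ^ 2 + b ^ 2)" using k(3,4) by (simp add: algebra_simps)
  have "coprime (int p) (int q)"
  proof (cases "odd a \<and> odd b")
    case True
    then have "c = 1" by (simp add: c_def pyth_scale_def)
    then show ?thesis
      using cop k(2) twoq by (metis coprime_mult_right_iff mult_1)
  next
    case False
    then have c2: "c = 2" by (auto simp: c_def pyth_scale_def)
    then have q: "int q = a ^ 2 + b ^ 2" using twoq by simp
    have "odd (int q)"
      using False assms(4) unfolding q by (auto dest: coprime_common_divisor[where c = 2])
    then have "coprime 2 (int q)" by simp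
    then show ?thesis using cop k(2) c2 q by (metis coprime_mult_left_iff)
  qed
  then show ?thesis using 1 2 3 unfolding pq S_set_iff by auto
qed

text \<open>The pair \<open>(p, q)\<close> determines \<open>k\<close>, hence \<open>c * a^2\<close>
  and \<open>c * b^2\<close>. The scales cannot be confused: scale 1 means that \<open>a\<close> is
  odd, and an odd square is not twice a square.\<close>

lemma inj_on_pyth_pair: "inj_on pyth_pair {(a, b). 0 < a \<and> a \<le> b}"
proof (rule inj_onI, clarify)
  fix a b a' b' :: int
  assume ab: "0 < a" "a \<le> b" and ab': "0 < a'" "a' \<le> b'" and eq: "pyth_pair (a, b) = pyth_pair (a', b')"
  obtain p q where pq: "pyth_pair (a, b) = (p, q)" by force
  obtain k where k: "k \<ge> 0" "int q + k = pyth_scale (a, b) * b ^ 2"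
    "int q - k = pyth_scale (a, b) * a ^ 2" "int p ^ 2 + k ^ 2 = int q ^ 2"
    using pyth_pair_eqs[OF ab pq] by metis
  obtain k' where k': "k' \<ge> 0" "int q + k' = pyth_scale (a', b') * b' ^ 2"
    "int q - k' = pyth_scale (a', b') * a' ^ 2" "int p ^ 2 + k' ^ 2 = int q ^ 2"
    using pyth_pair_eqs[OF ab' pq[unfolded eq]] by metis
  have "k ^ 2 = k' ^ 2" using k(4) k'(4) by simp
  then have "k = k'" using k(1) k'(1) by (simp add: power2_eq_iff_nonneg)
  then have e: "pyth_scale (a, b) * b ^ 2 = pyth_scale (a', b') * b' ^ 2"
    "pyth_scale (a, b) * a ^ 2 = pyth_scale (a', b') * a' ^ 2" using k k' by simp_all
  have ne: False if "x ^ 2 = 2 * y ^ 2" "odd x" for x y :: int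
    using that by (metis even_mult_iff even_numeral even_power)
  have "pyth_scale (a, b) = pyth_scale (a', b')"
    using e ne[of a a'] ne[of a' a] by (auto simp: pyth_scale_def split: if_splits)
  moreover have "pyth_scale (a, b) \<noteq> 0" by (simp add: pyth_scale_def)
  ultimately have "b ^ 2 = b' ^ 2" "a ^ 2 = a' ^ 2" using e by simp_all
  then show "a = a' \<and> b = b'" using ab ab' by (simp add: power2_eq_iff_nonneg)
qed

text \<open>In \<open>p^2 = (q - k) * (q + k)\<close> the factors become coprime with square product
  once the common factor 1 or 2 is removed, so each is a square.\<close>

lemma S_set_subset_pyth_pair:
  assumes "(p, q) \<in> S_set"
  obtains a b where "0 < a" "a \<le> b" "b ^ 2 < 3 * a ^ 2" "coprime a b" "pyth_pair (a, b) = (p, q)"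
proof (cases "p = 1 \<and> q = 1")
  case True
  then show ?thesis by (intro that[of 1 1]) (auto simp: pyth_pair_def pyth_scale_def)
next
  case False
  note found = that
  from False obtain k where k: "p < q" "coprime p q" "3 * q ^ 2 < 4 * p ^ 2" "p ^ 2 + k ^ 2 = q ^ 2"
    using assms by (auto simp: S_set_iff)
  have p0: "p > 0" using k(3) by (cases p) auto
  have "(2 * k) ^ 2 < q ^ 2" using k(3,4) by (simp add: power_mult_distrib)
  then have kq: "2 * k < q" by (rule power2_less_imp_less) simp
  have fac: "p ^ 2 = (q - k) * (q + k)"
  proof -
    have "(q - k) * (q + k) = q ^ 2 - k ^ 2" using kq by (simp add: power2_eq_square diff_mult_distrib add_mult_distrib2)
    then show ?thesis using k(4) by simp
  qed
  have cop_qk: "coprime q k"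
  proof (rule coprimeI)
    fix r assume "r dvd q" "r dvd k"
    then have "r ^ 2 dvd q ^ 2 - k ^ 2" by (intro dvd_diff_nat) (auto simp: dvd_power_same)
    then have "r ^ 2 dvd p ^ 2" using k(4) by (metis add_diff_cancel_right')
    then have "r dvd p" by simp
    then show "is_unit r" using \<open>r dvd q\<close> by (rule coprime_common_divisor[OF k(2)])
  qed
  \<comment> \<open>Shared end of both parity cases: \<open>m\<close> and \<open>n\<close> are
    \<open>q - k\<close> and \<open>q + k\<close> divided by \<open>c\<close>, with
    \<open>c = 1\<close> for odd \<open>p\<close> and \<open>c = 2\<close> for even
    \<open>p\<close>.\<close>
  have result: thesis if m: "m * c = q - k" and n: "n * c = q + k" and mn: "coprime m n" and pc: "p = c * p'" "p' ^ 2 = m * n"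
    and c: "c > 0" and scale: "\<And>x y. m = x ^ 2 \<Longrightarrow> n = y ^ 2 \<Longrightarrow> pyth_scale (int x, int y) = int c" for m n c p'
  proof -
    have "is_nth_power 2 (m * n)" using pc(2) by (metis is_nth_powerI)
    then have "is_nth_power 2 m" "is_nth_power 2 n"
      using is_nth_power_mult_coprime_nat_iff[OF mn] by auto
    then obtain x y where xy: "m = x ^ 2" "n = y ^ 2" by (auto simp: is_nth_power_def)
    have s: "pyth_scale (int x, int y) = int c" by (rule scale[OF xy])
    have "p' ^ 2 = (x * y) ^ 2" using pc(2) xy by (simp add: power_mult_distrib)
    then have p': "p' = x * y" by (simp add: power2_eq_iff_nonneg)
    have m0: "x > 0" using m kq xy c by (cases x) auto
    have "m * c \<le> n * c" using m n by simp
    then have "x ^ 2 \<le> y ^ 2" using c xy by simp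
    then have le: "x \<le> y" by (simp add: power2_nat_le_eq_le)
    have "n * c < (3 * m) * c" using m n kq by simp
    then have "y ^ 2 < 3 * x ^ 2" using c xy by simp
    then have "int (y ^ 2) < int (3 * x ^ 2)" by (simp only: of_nat_less_iff)
    then have lt: "int y ^ 2 < 3 * int x ^ 2" by simp
    have cop: "coprime (int x) (int y)" using mn xy by (simp add: coprime_int_iff)
    have "c * (x ^ 2 + y ^ 2) = 2 * q" using m n xy kq by (simp add: algebra_simps)
    then have "int (c * (x ^ 2 + y ^ 2)) = int (2 * q)" by simp
    then have "int c * (int x ^ 2 + int y ^ 2) = 2 * int q" by simp
    then have "pyth_pair (int x, int y) = (p, q)"
      using pc(1) p' by (simp add: pyth_pair_def s nat_mult_distrib)
    then show thesis using found[of "int x" "int y"] m0 le lt cop by simp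
  qed
  \<comment> \<open>For even \<open>q\<close> both \<open>p\<close> and \<open>k\<close> would be
    odd, but a sum of two odd squares is 2 modulo 4.\<close>
  have parity: "odd q"
  proof
    assume "even q"
    then have "odd p" "odd k" using k(2) cop_qk by (auto dest: coprime_common_divisor[where c = 2])
    then obtain u v w where "p = 2 * u + 1" "k = 2 * v + 1" "q = 2 * w"
      using \<open>even q\<close> by (auto elim!: oddE evenE)
    then have "4 * (u ^ 2 + u + v ^ 2 + v) + 2 = 4 * w ^ 2"
      using k(4) by (simp add: power2_eq_square algebra_simps)
    then show False by presburger
  qed
  show thesis
  proof (cases "odd p")
    case True
    have "even k"
    proof (rule ccontr)
      assume "odd k"
      then have "even (p ^ 2 + k ^ 2)" using True by simp
      then show False using parity k(4) by simp
    qed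
    have "coprime (q - k) (q + k)"
    proof (rule coprimeI)
      fix r assume r: "r dvd q - k" "r dvd q + k"
      have "r dvd (q - k) + (q + k)" "r dvd (q + k) - (q - k)"
        using r by (auto intro: dvd_diff_nat)
      then have "r dvd 2 * q" "r dvd 2 * k" using kq by (simp_all add: mult_2)
      moreover have "coprime r 2"
        using r(2) parity \<open>even k\<close> by (metis coprime_right_2_iff_odd dvd_trans even_add)
      ultimately have "r dvd q" "r dvd k" by (simp_all add: coprime_dvd_mult_right_iff)
      then show "is_unit r" by (rule coprime_common_divisor[OF cop_qk])
    qed
    moreover have "pyth_scale (int x, int y) = int 1" if "q - k = x ^ 2" "q + k = y ^ 2" for x y
    proof -
      have "odd (q - k)" "odd (q + k)" using parity \<open>even k\<close> kq by auto
      then show ?thesis unfolding that by (simp add: pyth_scale_def)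
    qed
    ultimately show ?thesis using fac by (intro result[of "q - k" 1 "q + k" p]) auto
  next
    case False
    have "odd k" using False parity k(4) by (metis even_add even_power pos2)
    obtain p' where p': "p = 2 * p'" using False by (auto elim!: evenE)
    obtain m where m: "q - k = 2 * m" using parity \<open>odd k\<close> kq by (metis evenE even_diff_nat odd_even_add nat_less_le less_or_eq_imp_le even_add)
    obtain n where n: "q + k = 2 * n" using parity \<open>odd k\<close> by (metis evenE odd_even_add)
    have mnq: "m + n = q" "n - m = k" "m \<le> n" using m n kq by linarith+
    have "p' ^ 2 = m * n" using fac unfolding p' m n by (simp add: power2_eq_square)
    moreover have "coprime m n"
    proof (rule coprimeI)
      fix r assume "r dvd m" "r dvd n"
      then have "r dvd q" "r dvd k" using mnq by (auto intro: dvd_diff_nat)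
      then show "is_unit r" by (rule coprime_common_divisor[OF cop_qk])
    qed
    moreover have "pyth_scale (int x, int y) = int 2" if "m = x ^ 2" "n = y ^ 2" for x y
    proof -
      have "odd (x ^ 2 + y ^ 2)" using that mnq parity by simp
      then show ?thesis by (auto simp: pyth_scale_def)
    qed
    ultimately show ?thesis using p' m n by (intro result[of m 2 n p']) auto
  qed
qed

lemma bij_betw_pyth_pair: "bij_betw pyth_pair (sector 1 (sqrt 3) \<inter> {(a, b). coprime a b}) S_set"
  unfolding bij_betw_def
proof
  show "inj_on pyth_pair (sector 1 (sqrt 3) \<inter> {(a, b). coprime a b})"
    by (rule inj_on_subset[OF inj_on_pyth_pair]) (auto simp: sector_1_sqrt3_iff)
  show "pyth_pair ` (sector 1 (sqrt 3) \<inter> {(a, b). coprime a b}) = S_set"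
  proof (intro equalityI subsetI)
    fix z assume "z \<in> S_set"
    obtain p q where z: "z = (p, q)" by force
    from S_set_subset_pyth_pair[OF \<open>z \<in> S_set\<close>[unfolded z]] obtain a b where
      "0 < a" "a \<le> b" "b ^ 2 < 3 * a ^ 2" "coprime a b" "pyth_pair (a, b) = (p, q)" .
    then show "z \<in> pyth_pair ` (sector 1 (sqrt 3) \<inter> {(a, b). coprime a b})"
      unfolding z by (intro image_eqI[of _ _ "(a, b)"]) (auto simp: sector_1_sqrt3_iff)
  qed (auto simp: sector_1_sqrt3_iff intro!: pyth_pair_in_S_set)
qed

text \<open>A coprime pair is never even in both coordinates. On each remaining piece
  \<open>pyth_scale\<close> is constant.\<close>

lemma coprime_pairs_split:
  "X \<inter> {(a, b). coprime a b} = (X \<inter> {(a, b). odd a \<and> odd b} \<inter> {(a, b). coprime a b}) \<union>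
     (X \<inter> {(a :: int, b :: int). even a \<longleftrightarrow> odd b} \<inter> {(a, b). coprime a b})"
  by (auto dest: coprime_common_divisor[where c = 2])

lemma S_set_numerator_pole: "dirichlet_pole 1 (\<lambda>(p, q). real p) S_set"
proof (rule dirichlet_pole_bij_betw[OF bij_betw_pyth_pair])
  show "(case pyth_pair z of (p, q) \<Rightarrow> real p) = (case z of (a, b) \<Rightarrow> pyth_scale (a, b) * real_of_int (a * b))"
    if "z \<in> sector 1 (sqrt 3) \<inter> {(a, b). coprime a b}" for z
    using that by (auto simp: sector_1_sqrt3_iff pyth_pair_def pyth_scale_def)
  show "dirichlet_pole 1 (\<lambda>(a, b). pyth_scale (a, b) * real_of_int (a * b)) (sector 1 (sqrt 3) \<inter> {(a, b). coprime a b})"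
    unfolding coprime_pairs_split[of "sector 1 (sqrt 3)"]
  proof (rule dirichlet_pole_Un)
    show "dirichlet_pole 1 (\<lambda>(a, b). pyth_scale (a, b) * real_of_int (a * b))
      (sector 1 (sqrt 3) \<inter> {(a, b). odd a \<and> odd b} \<inter> {(a, b). coprime a b})"
      by (rule dirichlet_pole_cong[THEN iffD1, OF _ sector_product_coprime_poles(1)[of _ _ 1]])
         (auto simp: pyth_scale_def)
    show "dirichlet_pole 1 (\<lambda>(a, b). pyth_scale (a, b) * real_of_int (a * b))
      (sector 1 (sqrt 3) \<inter> {(a, b). even a \<longleftrightarrow> odd b} \<inter> {(a, b). coprime a b})"
      by (rule dirichlet_pole_cong[THEN iffD1, OF _ sector_product_coprime_poles(2)[of _ _ 2]])
         (auto simp: pyth_scale_def)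
  qed auto
qed

lemma S_set_denominator_pole: "dirichlet_pole 1 (\<lambda>(p, q). real q) S_set"
proof (rule dirichlet_pole_bij_betw[OF bij_betw_pyth_pair])
  show "(case pyth_pair z of (p, q) \<Rightarrow> real q) = (case z of (a, b) \<Rightarrow> pyth_scale (a, b) / 2 * real_of_int (a ^ 2 + b ^ 2))"
    if "z \<in> sector 1 (sqrt 3) \<inter> {(a, b). coprime a b}" for z
  proof -
    obtain a b where z: "z = (a, b)" by force
    obtain p q where pq: "pyth_pair (a, b) = (p, q)" by force
    have ab: "0 < a" "a \<le> b" using that by (auto simp: z sector_1_sqrt3_iff)
    obtain k where "int q + k = pyth_scale (a, b) * b ^ 2" "int q - k = pyth_scale (a, b) * a ^ 2"
      using pyth_pair_eqs[OF ab pq] by metis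
    then have "2 * int q = pyth_scale (a, b) * (a ^ 2 + b ^ 2)" by (simp add: algebra_simps)
    then have "real_of_int (2 * int q) = real_of_int (pyth_scale (a, b) * (a ^ 2 + b ^ 2))" by simp
    then show ?thesis unfolding z pq by simp
  qed
  show "dirichlet_pole 1 (\<lambda>(a, b). pyth_scale (a, b) / 2 * real_of_int (a ^ 2 + b ^ 2)) (sector 1 (sqrt 3) \<inter> {(a, b). coprime a b})"
    unfolding coprime_pairs_split[of "sector 1 (sqrt 3)"]
  proof (rule dirichlet_pole_Un)
    show "dirichlet_pole 1 (\<lambda>(a, b). pyth_scale (a, b) / 2 * real_of_int (a ^ 2 + b ^ 2))
      (sector 1 (sqrt 3) \<inter> {(a, b). odd a \<and> odd b} \<inter> {(a, b). coprime a b})"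
      by (rule dirichlet_pole_cong[THEN iffD1, OF _ sector_norm_poles(3)[of _ _ "1 / 2"]])
         (auto simp: pyth_scale_def)
    show "dirichlet_pole 1 (\<lambda>(a, b). pyth_scale (a, b) / 2 * real_of_int (a ^ 2 + b ^ 2))
      (sector 1 (sqrt 3) \<inter> {(a, b). even a \<longleftrightarrow> odd b} \<inter> {(a, b). coprime a b})"
      by (rule dirichlet_pole_cong[THEN iffD1, OF _ sector_norm_poles(4)[of _ _ 1]])
         (auto simp: pyth_scale_def)
  qed auto
qed

section \<open>Well-rounded lattices\<close>


definition sqnorm :: "int \<times> int \<Rightarrow> int" where
  "sqnorm u = fst u ^ 2 + snd u ^ 2"

definition dot2 :: "int \<times> int \<Rightarrow> int \<times> int \<Rightarrow> int" where
  "dot2 u v = fst u * fst v + snd u * snd v"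

definition lincomb2 :: "int \<Rightarrow> int \<times> int \<Rightarrow> int \<Rightarrow> int \<times> int \<Rightarrow> int \<times> int" where
  "lincomb2 i u j v = (i * fst u + j * fst v, i * snd u + j * snd v)"

lemma zspan2_eq: "zspan2 u v = {lincomb2 i u j v | i j. True}"
  by (simp add: zspan2_def lincomb2_def)

lemma lincomb2_in_zspan2: "lincomb2 i u j v \<in> zspan2 u v"
  by (auto simp: zspan2_eq)

lemma zspan2E:
  assumes "w \<in> zspan2 u v"
  obtains i j where "w = lincomb2 i u j v"
  using assms unfolding zspan2_eq by blast

lemma zspan2_basis: "u \<in> zspan2 u v" "v \<in> zspan2 u v"
  using lincomb2_in_zspan2[of 1 u 0 v] lincomb2_in_zspan2[of 0 u 1 v] by (simp_all add: lincomb2_def)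

lemma zspan2_closed:
  assumes "x \<in> zspan2 u v" "y \<in> zspan2 u v"
  shows "lincomb2 i x j y \<in> zspan2 u v"
proof -
  obtain k l k' l' where "x = lincomb2 k u l v" "y = lincomb2 k' u l' v"
    using assms by (auto simp: zspan2_eq)
  then have "lincomb2 i x j y = lincomb2 (i * k + j * k') u (i * l + j * l') v"
    by (simp add: lincomb2_def algebra_simps)
  then show ?thesis by (simp add: lincomb2_in_zspan2)
qed

lemma zspan2_subset: "x \<in> zspan2 u v \<Longrightarrow> y \<in> zspan2 u v \<Longrightarrow> zspan2 x y \<subseteq> zspan2 u v"
  by (blast elim: zspan2E[of _ x y] intro: zspan2_closed)

lemma det2_lincomb2:
  "det2 (lincomb2 i u j v) (lincomb2 k u l v) = (i * l - j * k) * det2 u v"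
  by (simp add: det2_def lincomb2_def algebra_simps)

lemma sqnorm_lincomb2:
  "sqnorm (lincomb2 i u j v) = i ^ 2 * sqnorm u + j ^ 2 * sqnorm v + 2 * i * j * dot2 u v"
  by (simp add: sqnorm_def dot2_def lincomb2_def algebra_simps power2_eq_square)

lemma lagrange_identity2: "det2 u v ^ 2 + dot2 u v ^ 2 = sqnorm u * sqnorm v"
  by (simp add: det2_def dot2_def sqnorm_def algebra_simps power2_eq_square)

lemma det2_dvd:
  assumes "zspan2 u' v' \<subseteq> zspan2 u v"
  shows "det2 u v dvd det2 u' v'"
proof -
  have "u' \<in> zspan2 u v" "v' \<in> zspan2 u v" using assms zspan2_basis by blast+
  then show ?thesis by (elim zspan2E) (simp add: det2_lincomb2)
qed

text \<open>Determinants of two bases of one lattice divide each other, so the definite description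
  is well defined.\<close>

lemma lattice_det_zspan2:
  assumes "det2 u v \<noteq> 0"
  shows "lattice_det (zspan2 u v) = real_of_int \<bar>det2 u v\<bar>"
  unfolding lattice_det_def
proof (rule the_equality)
  fix D assume "\<exists>u' v'. det2 u' v' \<noteq> 0 \<and> zspan2 u v = zspan2 u' v' \<and> D = real_of_int \<bar>det2 u' v'\<bar>"
  then obtain u' v' where "zspan2 u v = zspan2 u' v'" "D = real_of_int \<bar>det2 u' v'\<bar>" by blast
  moreover from this have "\<bar>det2 u v\<bar> = \<bar>det2 u' v'\<bar>"
    by (intro zdvd_antisym_abs det2_dvd) auto
  ultimately show "D = real_of_int \<bar>det2 u v\<bar>" by simp
qed (use assms in blast)

lemma inorm_eq: "inorm u = sqrt (real_of_int (sqnorm u))"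
  by (simp add: inorm_def sqnorm_def)

lemma sqnorm_pos: "u \<noteq> (0, 0) \<Longrightarrow> sqnorm u > 0"
  by (cases u) (auto simp: sqnorm_def sum_power2_gt_zero_iff)

section \<open>Minimal bases of well-rounded lattices\<close>

text \<open>Equal lengths and an angle strictly between 60 and 120 degrees. Strictness leaves
  exactly four minimal vectors; with equality allowed, the hexagonal lattice would have six.\<close>

definition rhombic :: "int \<times> int \<Rightarrow> int \<times> int \<Rightarrow> bool" where
  "rhombic u v \<longleftrightarrow> sqnorm u = sqnorm v \<and> 2 * \<bar>dot2 u v\<bar> < sqnorm u"

lemma rhombic_det2_nonzero:
  assumes "rhombic u v"
  shows "det2 u v \<noteq> 0"
proof
  assume "det2 u v = 0"
  then have "dot2 u v ^ 2 = sqnorm u ^ 2"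
    using lagrange_identity2[of u v] assms by (simp add: rhombic_def power2_eq_square)
  then have "\<bar>dot2 u v\<bar> = \<bar>sqnorm u\<bar>" by (simp add: abs_eq_iff power2_eq_iff)
  then show False using assms by (auto simp: rhombic_def)
qed

text \<open>If \<open>i * j\<close> is nonzero, the cross term is smaller than
  \<open>|i * j| * N\<close>, and \<open>i^2 + j^2 - |i * j| = (|i| - |j|)^2 + |i * j|\<close> is at
  least 1; such vectors are therefore strictly longer than \<open>u\<close>.\<close>

lemma rhombic_sqnorm_lincomb2:
  assumes uv: "rhombic u v" and ij: "(i, j) \<noteq> (0, 0)"
  shows "sqnorm (lincomb2 i u j v) \<ge> sqnorm u"
    and "sqnorm (lincomb2 i u j v) = sqnorm u \<Longrightarrow> (i, j) \<in> {(1, 0), (- 1, 0), (0, 1), (0, - 1)}"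
proof -
  define N where "N = sqnorm u"
  have N: "sqnorm v = N" "2 * \<bar>dot2 u v\<bar> < N" using uv by (simp_all add: N_def rhombic_def)
  then have N0: "N > 0" by linarith
  have eq: "sqnorm (lincomb2 i u j v) = (i ^ 2 + j ^ 2) * N + 2 * (i * j) * dot2 u v"
    by (simp add: sqnorm_lincomb2 N flip: N_def) (simp add: algebra_simps)
  have "sqnorm (lincomb2 i u j v) \<ge> N \<and> (sqnorm (lincomb2 i u j v) = N \<longrightarrow> (i, j) \<in> {(1, 0), (- 1, 0), (0, 1), (0, - 1)})"
  proof (cases "i * j = 0")
    case True
    define t where "t = i + j"
    have t: "t \<noteq> 0" "i ^ 2 + j ^ 2 = t ^ 2" using True ij by (auto simp: t_def)
    have "t ^ 2 \<ge> 1" using t(1) by (simp add: int_one_le_iff_zero_less)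
    then have "1 * N \<le> t ^ 2 * N" using N0 by (intro mult_right_mono) auto
    moreover have "t = 1 \<or> t = - 1" if "t ^ 2 * N = N" using that N0 by (simp add: power2_eq_1_iff)
    ultimately show ?thesis using True unfolding eq t(2) by (auto simp: t_def)
  next
    case False
    have "\<bar>2 * (i * j) * dot2 u v\<bar> = \<bar>i * j\<bar> * (2 * \<bar>dot2 u v\<bar>)" by (simp add: abs_mult)
    also have "\<dots> < \<bar>i * j\<bar> * N" using False N by (intro mult_strict_left_mono) auto
    finally have *: "(i ^ 2 + j ^ 2) * N - \<bar>i * j\<bar> * N < sqnorm (lincomb2 i u j v)"
      unfolding eq by linarith
    have "((\<bar>i\<bar> - \<bar>j\<bar>) ^ 2 + \<bar>i * j\<bar>) * N = (i ^ 2 + j ^ 2) * N - \<bar>i * j\<bar> * N"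
      by (simp add: power2_diff abs_mult algebra_simps)
    also note *
    finally have gt: "((\<bar>i\<bar> - \<bar>j\<bar>) ^ 2 + \<bar>i * j\<bar>) * N < sqnorm (lincomb2 i u j v)" .
    have "1 * N \<le> ((\<bar>i\<bar> - \<bar>j\<bar>) ^ 2 + \<bar>i * j\<bar>) * N"
    proof (rule mult_right_mono)
      have "\<bar>i * j\<bar> \<ge> 1" using False by linarith
      then show "1 \<le> (\<bar>i\<bar> - \<bar>j\<bar>) ^ 2 + \<bar>i * j\<bar>" by (simp add: add_increasing)
    qed (use N0 in simp)
    with gt show ?thesis by simp
  qed
  then show "sqnorm (lincomb2 i u j v) \<ge> sqnorm u"
    "sqnorm (lincomb2 i u j v) = sqnorm u \<Longrightarrow> (i, j) \<in> {(1, 0), (- 1, 0), (0, 1), (0, - 1)}"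
    by (auto simp: N_def)
qed

lemma rhombic_minimal_vectors:
  assumes uv: "rhombic u v" and w: "w \<in> zspan2 u v" "sqnorm w = sqnorm u"
  shows "w \<in> {u, - u, v, - v}"
proof -
  obtain i j where ij: "w = lincomb2 i u j v" using w by (auto simp: zspan2_eq)
  have "sqnorm u > 0" using uv by (auto simp: rhombic_def)
  then have "(i, j) \<noteq> (0, 0)" using w(2) ij by (auto simp: sqnorm_lincomb2)
  then have "(i, j) \<in> {(1, 0), (- 1, 0), (0, 1), (0, - 1)}"
    using rhombic_sqnorm_lincomb2(2)[OF uv] w(2) ij by blast
  then show ?thesis by (auto simp: ij lincomb2_def prod_eq_iff)
qed

lemma lattice_min_rhombic:
  assumes "rhombic u v"
  shows "lattice_min (zspan2 u v) = sqrt (real_of_int (sqnorm u))"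
  unfolding lattice_min_def
proof (rule cInf_eq_minimum)
  have "sqnorm u > 0" using assms by (auto simp: rhombic_def)
  then have "u \<noteq> (0, 0)" by (auto simp: sqnorm_def)
  then show "sqrt (real_of_int (sqnorm u)) \<in> inorm ` (zspan2 u v - {(0, 0)})"
    by (intro image_eqI[of _ _ u]) (auto simp: inorm_eq zspan2_basis)
next
  fix y assume "y \<in> inorm ` (zspan2 u v - {(0, 0)})"
  then obtain w where "w \<in> zspan2 u v" and w: "w \<noteq> (0, 0)" "y = inorm w" by blast
  then obtain i j where "w = lincomb2 i u j v" by (blast elim: zspan2E)
  with w have y: "y = inorm (lincomb2 i u j v)" "lincomb2 i u j v \<noteq> (0, 0)" by simp_all
  have "(i, j) \<noteq> (0, 0)" using y(2) by (auto simp: lincomb2_def)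
  then show "sqrt (real_of_int (sqnorm u)) \<le> y"
    using rhombic_sqnorm_lincomb2(1)[OF assms] by (simp add: y inorm_eq)
qed

lemma rhombic_in_WR:
  assumes "rhombic u v"
  shows "zspan2 u v \<in> WR_Z2"
proof -
  have "sqnorm u > 0" "sqnorm v > 0" using assms by (auto simp: rhombic_def)
  then have "u \<noteq> (0, 0)" "v \<noteq> (0, 0)" by (auto simp: sqnorm_def)
  moreover have "inorm u = lattice_min (zspan2 u v)" "inorm v = lattice_min (zspan2 u v)"
    using assms by (simp_all add: lattice_min_rhombic inorm_eq rhombic_def)
  ultimately show ?thesis
    using rhombic_det2_nonzero[OF assms] zspan2_basis
    unfolding WR_Z2_def full_rank_sublattice_def well_rounded_def by blast
qed

text \<open>For nonzero \<open>y\<close> the exponent of 3 would be even on the left and odd on the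
  right.\<close>

lemma square_eq_3_square:
  fixes x y :: int
  assumes "x ^ 2 = 3 * y ^ 2"
  shows "y = 0"
proof (rule ccontr)
  assume y: "y \<noteq> 0"
  have p: "prime (3 :: int)" by simp
  have x: "x \<noteq> 0" using assms y by auto
  have "multiplicity 3 (x ^ 2) = 2 * multiplicity 3 x"
    using x p by (simp add: prime_elem_multiplicity_power_distrib)
  moreover have "multiplicity 3 (3 * y ^ 2) = 1 + 2 * multiplicity 3 y"
    using y p by (simp add: prime_elem_multiplicity_mult_distrib prime_elem_multiplicity_power_distrib)
  ultimately have "2 * multiplicity 3 x = 1 + 2 * multiplicity 3 y" using assms by simp
  then show False by presburger
qed

lemma nearest_multiple:
  fixes A D :: int
  assumes "D \<noteq> 0"
  obtains i where "2 * \<bar>A - i * D\<bar> \<le> \<bar>D\<bar>"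
proof -
  define i where "i = round (real_of_int A / real_of_int D)"
  have "\<bar>real_of_int i - real_of_int A / real_of_int D\<bar> \<le> 1 / 2"
    unfolding i_def by (rule of_int_round_abs_le)
  then have "\<bar>real_of_int i - real_of_int A / real_of_int D\<bar> * \<bar>real_of_int D\<bar> \<le> 1 / 2 * \<bar>real_of_int D\<bar>"
    by (rule mult_right_mono) simp
  then have "\<bar>real_of_int i * real_of_int D - real_of_int A\<bar> \<le> 1 / 2 * \<bar>real_of_int D\<bar>"
    using assms by (simp add: abs_mult[symmetric] left_diff_distrib)
  then have "real_of_int (2 * \<bar>A - i * D\<bar>) \<le> real_of_int \<bar>D\<bar>" by (simp add: abs_minus_commute)
  then show ?thesis using that by (simp only: of_int_le_iff)
qed

text \<open>For independent minimal \<open>u\<close>, \<open>v\<close> the vectors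
  \<open>u + v\<close> and \<open>u - v\<close> are no shorter, which gives
  \<open>2 * |dot2 u v| \<le> N\<close>; equality would make \<open>3 * N^2\<close> a square by the
  Lagrange identity. The pair generates \<open>L\<close> because rounding the coordinates of any
  \<open>w\<close> leaves a remainder of squared length at most three quarters of
  \<open>N\<close>.\<close>

lemma WR_imp_rhombic:
  assumes "L \<in> WR_Z2"
  obtains u v where "rhombic u v" "L = zspan2 u v"
proof -
  obtain u0 v0 where L0: "L = zspan2 u0 v0" using assms by (auto simp: WR_Z2_def full_rank_sublattice_def)
  obtain u v where uv: "u \<in> L" "v \<in> L" "inorm u = lattice_min L" "inorm v = lattice_min L" "det2 u v \<noteq> 0"
    "u \<noteq> (0, 0)"
    using assms by (auto simp: WR_Z2_def well_rounded_def)
  define N where "N = sqnorm u"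
  have N0: "N > 0" unfolding N_def by (rule sqnorm_pos[OF uv(6)])
  have "inorm v = inorm u" using uv by simp
  then have Nv: "sqnorm v = N" by (simp add: inorm_eq N_def)
  have closed: "lincomb2 i x j y \<in> L" if "x \<in> L" "y \<in> L" for i x j y
    using that zspan2_closed unfolding L0 by blast
  have minimal: "sqnorm w \<ge> N" if "w \<in> L" "w \<noteq> (0, 0)" for w
  proof -
    have "lattice_min L \<le> inorm w" unfolding lattice_min_def
      using that by (intro cInf_lower bdd_belowI[of _ 0]) (auto simp: inorm_def)
    then show ?thesis unfolding uv(3)[symmetric] by (simp add: inorm_eq N_def)
  qed
  have ge: "2 * N + 2 * i * j * dot2 u v \<ge> N" if "i ^ 2 = 1" "j ^ 2 = 1" for i j
  proof -
    have "det2 (lincomb2 i u j v) v = i * det2 u v" by (simp add: det2_def lincomb2_def algebra_simps)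
    moreover have "i \<noteq> 0" using that by auto
    ultimately have "det2 (lincomb2 i u j v) v \<noteq> 0" using uv(5) by simp
    then have "lincomb2 i u j v \<noteq> (0, 0)" by (auto simp: det2_def)
    from minimal[OF closed[OF uv(1,2)] this] show ?thesis
      using that by (simp add: sqnorm_lincomb2 Nv flip: N_def)
  qed
  have dot: "2 * \<bar>dot2 u v\<bar> \<le> N" using ge[of 1 1] ge[of 1 "- 1"] by simp
  have "2 * \<bar>dot2 u v\<bar> \<noteq> N"
  proof
    assume "2 * \<bar>dot2 u v\<bar> = N"
    then have "4 * dot2 u v ^ 2 = N ^ 2" by (auto simp: power_mult_distrib)
    then have "(2 * det2 u v) ^ 2 = 3 * N ^ 2"
      using lagrange_identity2[of u v] by (simp add: Nv power2_eq_square flip: N_def)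
    then show False using square_eq_3_square N0 by blast
  qed
  then have rh: "rhombic u v" using dot Nv by (simp add: rhombic_def N_def)
  have "L \<subseteq> zspan2 u v"
  proof
    fix w assume w: "w \<in> L"
    \<comment> \<open>Cramer's rule with denominators cleared: the coordinates of \<open>w\<close>
      are \<open>det2 w v / D\<close> and \<open>det2 u w / D\<close>, and \<open>A\<close>,
      \<open>B\<close> below are \<open>D\<close> times their rounding errors.\<close>
    define D where "D = det2 u v"
    have D: "D \<noteq> 0" using uv(5) by (simp add: D_def)
    obtain i where i: "2 * \<bar>det2 w v - i * D\<bar> \<le> \<bar>D\<bar>" using nearest_multiple[OF D] .
    obtain j where j: "2 * \<bar>det2 u w - j * D\<bar> \<le> \<bar>D\<bar>" using nearest_multiple[OF D] .
    define A where "A = det2 w v - i * D"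
    define B where "B = det2 u w - j * D"
    define w' where "w' = lincomb2 1 w (- 1) (lincomb2 i u j v)"
    have w'L: "w' \<in> L" unfolding w'_def by (intro closed w uv)
    have Dw: "lincomb2 D w' 0 w' = lincomb2 A u B v"
      by (simp add: w'_def A_def B_def D_def lincomb2_def det2_def algebra_simps)
    have "w' = (0, 0)"
    proof (rule ccontr)
      assume "w' \<noteq> (0, 0)"
      then have "N \<le> sqnorm w'" by (rule minimal[OF w'L])
      then have "D ^ 2 * N \<le> D ^ 2 * sqnorm w'" by (intro mult_left_mono) auto
      also have "\<dots> = sqnorm (lincomb2 A u B v)" by (simp add: sqnorm_lincomb2 flip: Dw)
      also have "\<dots> = (A ^ 2 + B ^ 2) * N + (A * B) * (2 * dot2 u v)"
        by (simp add: sqnorm_lincomb2 Nv flip: N_def) (simp add: algebra_simps)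
      also have "\<dots> \<le> (A ^ 2 + B ^ 2) * N + \<bar>A * B\<bar> * N"
      proof -
        have "(A * B) * (2 * dot2 u v) \<le> \<bar>A * B\<bar> * (2 * \<bar>dot2 u v\<bar>)"
          using abs_ge_self[of "(A * B) * (2 * dot2 u v)"] by (simp add: abs_mult)
        also have "\<dots> \<le> \<bar>A * B\<bar> * N" by (intro mult_left_mono dot) auto
        finally show ?thesis by simp
      qed
      finally have "D ^ 2 * N \<le> (A ^ 2 + B ^ 2 + \<bar>A * B\<bar>) * N" by (simp add: algebra_simps)
      then have le: "D ^ 2 \<le> A ^ 2 + B ^ 2 + \<bar>A\<bar> * \<bar>B\<bar>" using N0 by (simp add: abs_mult)
      \<comment> \<open>Each of the three terms is at most \<open>D^2 / 4\<close>, so they reach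
        only three quarters of \<open>D^2\<close>.\<close>
      have "(2 * \<bar>A\<bar>) ^ 2 \<le> \<bar>D\<bar> ^ 2" "(2 * \<bar>B\<bar>) ^ 2 \<le> \<bar>D\<bar> ^ 2"
        using i j unfolding A_def B_def by (intro power_mono; simp)+
      moreover have "(2 * \<bar>A\<bar>) * (2 * \<bar>B\<bar>) \<le> \<bar>D\<bar> * \<bar>D\<bar>"
        using i j unfolding A_def B_def by (intro mult_mono) auto
      ultimately have "4 * A ^ 2 \<le> D ^ 2" "4 * B ^ 2 \<le> D ^ 2" "4 * (\<bar>A\<bar> * \<bar>B\<bar>) \<le> D ^ 2"
        by (simp_all add: power_mult_distrib power2_eq_square)
      moreover have "D ^ 2 > 0" using D by simp
      ultimately show False using le by linarith
    qed
    then have "w = lincomb2 i u j v" by (simp add: w'_def lincomb2_def prod_eq_iff)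
    then show "w \<in> zspan2 u v" by (simp add: lincomb2_in_zspan2)
  qed
  moreover have "zspan2 u v \<subseteq> L" using closed[OF uv(1,2)] by (auto simp: zspan2_eq[of u v])
  ultimately show ?thesis using that rh by blast
qed


section \<open>Parametrisation of well-rounded lattices by rhombi\<close>

text \<open>The argument is $(z, (a, b))$ with $z = m + in$, and $u + v = az$, $u - v = b\,iz$.\<close>
definition rhombus_u :: "(int \<times> int) \<times> (int \<times> int) \<Rightarrow> int \<times> int" where
  "rhombus_u = (\<lambda>((m, n), (a, b)). ((a * m - b * n) div 2, (a * n + b * m) div 2))"

definition rhombus_v :: "(int \<times> int) \<times> (int \<times> int) \<Rightarrow> int \<times> int" where
  "rhombus_v = (\<lambda>((m, n), (a, b)). ((a * m + b * n) div 2, (a * n - b * m) div 2))"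

definition rhombus_lattice :: "(int \<times> int) \<times> (int \<times> int) \<Rightarrow> (int \<times> int) set" where
  "rhombus_lattice x = zspan2 (rhombus_u x) (rhombus_v x)"

text \<open>The sector of $z$ is a fundamental domain for the units of the Gaussian integers, the sector
  of $(a, b)$ says that the angle between $u$ and $v$ lies between 60 and 120 degrees, and the parity
  conditions make $u$ and $v$ integral.\<close>
definition rhombus_params :: "((int \<times> int) \<times> (int \<times> int)) set" where
  "rhombus_params =
     (sector (- 1) 1 \<inter> {(m, n). even m \<longleftrightarrow> even n}) \<times>
       (sector (1 / sqrt 3) (sqrt 3) \<inter> {(a, b). odd a \<and> odd b} \<inter> {(a, b). coprime a b}) \<union>
     (sector (- 1) 1 \<inter> {(m, n). even m \<and> even n}) \<times>
       (sector (1 / sqrt 3) (sqrt 3) \<inter> {(a, b). even a \<longleftrightarrow> odd b} \<inter> {(a, b). coprime a b})"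

lemma sector_quarter_iff: "(m, n) \<in> sector (- 1) 1 \<longleftrightarrow> 0 < m \<and> - m \<le> n \<and> n < m"
  by (auto simp: sector_def)

text \<open>The lower boundary of the sector is closed, yet the inequality comes out strict because
  \<open>a^2 = 3 * b^2\<close> is impossible for nonzero \<open>b\<close>.\<close>

lemma sector_sqrt3_iff:
  "(a, b) \<in> sector (1 / sqrt 3) (sqrt 3) \<longleftrightarrow> 0 < a \<and> 0 < b \<and> a ^ 2 < 3 * b ^ 2 \<and> b ^ 2 < 3 * a ^ 2"
proof (cases "0 < a \<and> 0 < b")
  case True
  have "1 / sqrt 3 * real_of_int a \<le> real_of_int b \<longleftrightarrow> \<not> real_of_int b * sqrt 3 < real_of_int a"
    by (simp add: field_simps not_less)
  also have "real_of_int b * sqrt 3 < real_of_int a \<longleftrightarrow> sqrt (real_of_int (3 * b ^ 2)) < sqrt (real_of_int (a ^ 2))"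
    using True by (simp add: real_sqrt_mult mult.commute)
  also have "\<dots> \<longleftrightarrow> 3 * b ^ 2 < a ^ 2" by (simp only: real_sqrt_less_iff of_int_less_iff)
  also have "\<not> \<dots> \<longleftrightarrow> a ^ 2 < 3 * b ^ 2" using square_eq_3_square[of a b] True by fastforce
  finally show ?thesis using True less_sqrt3_mult_iff[of a b] by (simp add: sector_def)
next
  case False
  have "\<not> (1 / sqrt 3 * real_of_int a \<le> real_of_int b)" if "0 < a" "b \<le> 0"
  proof -
    have "real_of_int b \<le> 0" "0 < 1 / sqrt 3 * real_of_int a" using that by simp_all
    then show ?thesis by linarith
  qed
  then show ?thesis using False by (auto simp: sector_def)
qed

text \<open>The two evenness conditions say that \<open>u\<close> and \<open>v\<close> are integral.
  For odd \<open>a\<close>, \<open>b\<close> they ask \<open>m\<close> and \<open>n\<close> to have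
  equal parity; for opposite parities they force both to be even. Coprimality excludes even
  \<open>a\<close>, \<open>b\<close>.\<close>

lemma rhombus_params_iff:
  "((m, n), (a, b)) \<in> rhombus_params \<longleftrightarrow> 0 < m \<and> - m \<le> n \<and> n < m \<and>
     0 < a \<and> 0 < b \<and> a ^ 2 < 3 * b ^ 2 \<and> b ^ 2 < 3 * a ^ 2 \<and> coprime a b \<and>
     even (a * m + b * n) \<and> even (a * n + b * m)"
  by (auto simp: rhombus_params_def sector_quarter_iff sector_sqrt3_iff dest: coprime_common_divisor[where c = 2])

text \<open>With \<open>w = a + ib\<close> and \<open>z = m + in\<close> the vectors are
  \<open>u = w z / 2\<close> and \<open>v = conj(w) z / 2\<close>; dot product and determinant are
  the real and imaginary parts of \<open>conj(u) v\<close>. For positive \<open>a\<close>,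
  \<open>b\<close> and nonzero \<open>z\<close> the determinant is negative, which fixes the
  orientation.\<close>

lemma rhombus_vectors_identities:
  fixes a b m n :: int
  assumes "2 * fst u = a * m - b * n" "2 * snd u = a * n + b * m"
    "2 * fst v = a * m + b * n" "2 * snd v = a * n - b * m"
  shows "4 * sqnorm u = (a ^ 2 + b ^ 2) * (m ^ 2 + n ^ 2)" "4 * sqnorm v = (a ^ 2 + b ^ 2) * (m ^ 2 + n ^ 2)"
    "4 * dot2 u v = (a ^ 2 - b ^ 2) * (m ^ 2 + n ^ 2)" "2 * det2 u v = - (a * b * (m ^ 2 + n ^ 2))"
proof -
  have "4 * sqnorm u = (2 * fst u) ^ 2 + (2 * snd u) ^ 2" by (simp add: sqnorm_def power_mult_distrib)
  then show "4 * sqnorm u = (a ^ 2 + b ^ 2) * (m ^ 2 + n ^ 2)"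
    unfolding assms by (simp add: algebra_simps power2_eq_square)
  have "4 * sqnorm v = (2 * fst v) ^ 2 + (2 * snd v) ^ 2" by (simp add: sqnorm_def power_mult_distrib)
  then show "4 * sqnorm v = (a ^ 2 + b ^ 2) * (m ^ 2 + n ^ 2)"
    unfolding assms by (simp add: algebra_simps power2_eq_square)
  have "4 * dot2 u v = (2 * fst u) * (2 * fst v) + (2 * snd u) * (2 * snd v)" by (simp add: dot2_def)
  then show "4 * dot2 u v = (a ^ 2 - b ^ 2) * (m ^ 2 + n ^ 2)"
    unfolding assms by (simp add: algebra_simps power2_eq_square)
  have "2 * (2 * det2 u v) = (2 * fst u) * (2 * snd v) - (2 * snd u) * (2 * fst v)" by (simp add: det2_def)
  also have "\<dots> = 2 * - (a * b * (m ^ 2 + n ^ 2))"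
    unfolding assms by (simp add: algebra_simps power2_eq_square)
  finally show "2 * det2 u v = - (a * b * (m ^ 2 + n ^ 2))" by (simp only: mult_cancel_left zero_neq_numeral[symmetric]) simp
qed

text \<open>Cancelling \<open>Z\<close> leaves \<open>2 * |a^2 - b^2| < a^2 + b^2\<close>, whose two
  signs are the two inequalities.\<close>

lemma rhombus_ratio_iff:
  fixes a b Z N d :: int
  assumes "Z > 0" "4 * N = (a ^ 2 + b ^ 2) * Z" "4 * d = (a ^ 2 - b ^ 2) * Z"
  shows "2 * \<bar>d\<bar> < N \<longleftrightarrow> a ^ 2 < 3 * b ^ 2 \<and> b ^ 2 < 3 * a ^ 2"
proof -
  have "2 * \<bar>d\<bar> < N \<longleftrightarrow> 2 * (4 * d) < 4 * N \<and> - 2 * (4 * d) < 4 * N" by linarith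
  also have "\<dots> \<longleftrightarrow> 2 * (a ^ 2 - b ^ 2) * Z < (a ^ 2 + b ^ 2) * Z \<and> - 2 * (a ^ 2 - b ^ 2) * Z < (a ^ 2 + b ^ 2) * Z"
    unfolding assms by (simp only: mult.assoc)
  also have "\<dots> \<longleftrightarrow> 2 * (a ^ 2 - b ^ 2) < a ^ 2 + b ^ 2 \<and> - 2 * (a ^ 2 - b ^ 2) < a ^ 2 + b ^ 2"
    using assms(1) by (simp only: mult_less_cancel_right_pos)
  also have "\<dots> \<longleftrightarrow> a ^ 2 < 3 * b ^ 2 \<and> b ^ 2 < 3 * a ^ 2" by auto
  finally show ?thesis .
qed

lemma rhombus_vectors:
  assumes "((m, n), (a, b)) \<in> rhombus_params"
  defines "u \<equiv> rhombus_u ((m, n), (a, b))" and "v \<equiv> rhombus_v ((m, n), (a, b))"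
  shows "2 * fst u = a * m - b * n" "2 * snd u = a * n + b * m"
    "2 * fst v = a * m + b * n" "2 * snd v = a * n - b * m" "rhombic u v"
proof -
  have p: "0 < m" "a ^ 2 < 3 * b ^ 2" "b ^ 2 < 3 * a ^ 2" "even (a * m + b * n)" "even (a * n + b * m)"
    using assms(1) by (simp_all add: rhombus_params_iff)
  show eqs: "2 * fst u = a * m - b * n" "2 * snd u = a * n + b * m"
    "2 * fst v = a * m + b * n" "2 * snd v = a * n - b * m"
    using p(4,5) by (simp_all add: u_def v_def rhombus_u_def rhombus_v_def)
  note id = rhombus_vectors_identities[OF eqs]
  have Z: "m ^ 2 + n ^ 2 > 0" using p(1) by (simp add: add_pos_nonneg)
  show "rhombic u v"
    unfolding rhombic_def using rhombus_ratio_iff[OF Z id(1,3)] p id(1,2) by simp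
qed

text \<open>Equal lattices share their four minimal vectors, and the fixed orientation leaves four
  candidates for the second basis, the shifts of the cycle \<open>u, v, -u, -v\<close>. A nontrivial
  shift would put the second \<open>z\<close> in the direction of the first times a unit other than
  1, outside the half-open sector.\<close>

lemma rhombus_lattice_inj: "inj_on rhombus_lattice rhombus_params"
proof (rule inj_onI)
  fix x y assume x: "x \<in> rhombus_params" and y: "y \<in> rhombus_params" and eq: "rhombus_lattice x = rhombus_lattice y"
  obtain m n a b where xx: "x = ((m, n), (a, b))" by (metis surj_pair)
  obtain m' n' a' b' where yy: "y = ((m', n'), (a', b'))" by (metis surj_pair)
  define u where "u = rhombus_u x"
  define v where "v = rhombus_v x"
  define u' where "u' = rhombus_u y"
  define v' where "v' = rhombus_v y"
  note X = rhombus_vectors[OF x[unfolded xx], folded xx, folded u_def v_def]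
  note Y = rhombus_vectors[OF y[unfolded yy], folded yy, folded u'_def v'_def]
  have px: "0 < m" "- m \<le> n" "n < m" "0 < a" "0 < b" "coprime a b"
    using x by (simp_all add: xx rhombus_params_iff)
  have py: "0 < m'" "- m' \<le> n'" "n' < m'" "0 < a'" "0 < b'" "coprime a' b'"
    using y by (simp_all add: yy rhombus_params_iff)
  have L: "zspan2 u v = zspan2 u' v'" using eq by (simp add: rhombus_lattice_def u_def v_def u'_def v'_def)
  have "sqrt (real_of_int (sqnorm u)) = sqrt (real_of_int (sqnorm u'))"
    using lattice_min_rhombic[OF X(5)] lattice_min_rhombic[OF Y(5)] L by simp
  then have N: "sqnorm u' = sqnorm u" by simp
  have "sqnorm v' = sqnorm u" using N Y(5) by (simp add: rhombic_def)
  then have uv': "u' \<in> {u, - u, v, - v}" "v' \<in> {u, - u, v, - v}"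
    by (intro rhombic_minimal_vectors[OF X(5)]; simp add: L N zspan2_basis)+
  have det: "det2 u v < 0" "det2 u' v' < 0"
  proof -
    have "a * b * (m ^ 2 + n ^ 2) > 0" "a' * b' * (m' ^ 2 + n' ^ 2) > 0"
      using px py by (simp_all add: add_pos_nonneg)
    then show "det2 u v < 0" "det2 u' v' < 0"
      using rhombus_vectors_identities(4)[OF X(1-4)] rhombus_vectors_identities(4)[OF Y(1-4)] by linarith+
  qed
  have neg: "fst (- w) = - fst w" "snd (- w) = - snd w" for w :: "int \<times> int" by simp_all
  have detneg: "det2 (- w) z = - det2 w z" "det2 w (- z) = - det2 w z" "det2 w w = 0" "det2 v u = - det2 u v" for w z
    by (simp_all add: det2_def algebra_simps)
  have cases: "u' = u \<and> v' = v \<or> u' = - u \<and> v' = - v \<or> u' = v \<and> v' = - u \<or> u' = - v \<and> v' = u"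
    using uv' det by (auto simp: detneg)
  have sums: "2 * fst u' + 2 * fst v' = 2 * (a' * m')" "2 * snd u' + 2 * snd v' = 2 * (a' * n')"
    "2 * snd u' - 2 * snd v' = 2 * (b' * m')"
    unfolding Y by simp_all
  have le: "- (a' * m') \<le> a' * n'" "a' * n' < a' * m'" "0 < a' * m'"
    using py by (simp_all flip: mult_minus_right)
  have le2: "- (b * m) \<le> b * n" "b * n < b * m" "0 < a * m"
    using px by (simp_all flip: mult_minus_right)
  have same: "u' = u \<and> v' = v"
    using cases
  proof (elim disjE)
    assume "u' = - u \<and> v' = - v"
    then have "a' * m' = - (a * m)" using sums(1) X by (simp add: neg)
    then show ?thesis using le le2 by linarith
  next
    assume "u' = v \<and> v' = - u"
    then have "a' * m' = b * n" "a' * n' = - (b * m)" using sums(1,2) X by (simp_all add: neg)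
    then show ?thesis using le le2 by linarith
  next
    assume "u' = - v \<and> v' = u"
    then have "a' * m' = - (b * n)" "a' * n' = b * m" using sums(1,2) X by (simp_all add: neg)
    then show ?thesis using le le2 by linarith
  qed auto
  then have e: "a' * m' = a * m" "a' * n' = a * n" "b' * m' = b * m" using sums X by simp_all
  \<comment> \<open>Only products such as \<open>a * m\<close> and \<open>b * m\<close> are known so
    far. Eliminating \<open>m\<close> shows that the ratios \<open>a : b\<close> agree, and
    coprimality then fixes the pair.\<close>
  have "(a' * b) * (m' * m) = (a' * m') * (b * m)" by (simp add: algebra_simps)
  also have "\<dots> = (a * b') * (m' * m)" unfolding e(1) e(3)[symmetric] by (simp add: algebra_simps)
  finally have "a' * b = a * b'" using px py by simp
  moreover from this have "a dvd a'" "a' dvd a"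
    using px(6) py(6) by (metis coprime_dvd_mult_left_iff dvd_triv_left)+
  ultimately have "a = a'" using px(4) py(4) by (simp add: zdvd_antisym_nonneg)
  then have "m = m'" "n = n'" using e px by simp_all
  then have "b = b'" using e(3) px by simp
  then show "x = y" using \<open>a = a'\<close> \<open>m = m'\<close> \<open>n = n'\<close> by (simp add: xx yy)
qed

lemma zspan2_swap: "zspan2 u v = zspan2 v u"
  using zspan2_subset zspan2_basis by (metis subset_antisym)

lemma zspan2_uminus: "zspan2 (- u) v = zspan2 u v" "zspan2 u (- v) = zspan2 u v"
proof -
  have "- u \<in> zspan2 u v" "- v \<in> zspan2 u v" for u v
    using lincomb2_in_zspan2[of "- 1" u 0 v] lincomb2_in_zspan2[of 0 u "- 1" v]
    by (simp_all add: lincomb2_def prod_eq_iff uminus_prod_def)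
  note neg = this
  have "zspan2 (- u) v \<subseteq> zspan2 u v" "zspan2 u (- v) \<subseteq> zspan2 u v" for u v
    by (intro zspan2_subset neg zspan2_basis)+
  from this[of u v] this(1)[of "- u" v] this(2)[of u "- v"]
  show "zspan2 (- u) v = zspan2 u v" "zspan2 u (- v) = zspan2 u v" by auto
qed

text \<open>For a negatively oriented basis the diagonals \<open>x = u + v\<close> and
  \<open>y = u - v\<close> are orthogonal, and \<open>y\<close> is \<open>W / X\<close> times the
  quarter turn of \<open>x\<close>. With \<open>W / X = b / a\<close> in lowest terms,
  \<open>a\<close> divides both coordinates of \<open>x\<close>, which produces
  \<open>z\<close>.\<close>

lemma rhombus_lattice_surj:
  assumes "L \<in> WR_Z2"
  shows "L \<in> rhombus_lattice ` rhombus_params"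
proof -
  obtain u0 v0 where uv0: "rhombic u0 v0" "L = zspan2 u0 v0" using WR_imp_rhombic[OF assms] .
  have rh_swap: "rhombic v0 u0" using uv0(1) by (simp add: rhombic_def dot2_def mult.commute)
  have "det2 v0 u0 = - det2 u0 v0" by (simp add: det2_def)
  have "\<exists>u v. rhombic u v \<and> L = zspan2 u v \<and> det2 u v < 0"
  proof (cases "det2 u0 v0 < 0")
    case False
    then have "det2 v0 u0 < 0" using \<open>det2 v0 u0 = - det2 u0 v0\<close> rhombic_det2_nonzero[OF uv0(1)] by linarith
    then show ?thesis using rh_swap uv0(2) zspan2_swap by metis
  qed (use uv0 in blast)
  then obtain u v where uv: "rhombic u v" "L = zspan2 u v" "det2 u v < 0" by blast
  define x1 x2 y1 y2 where "x1 = fst u + fst v" and "x2 = snd u + snd v"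
    and "y1 = fst u - fst v" and "y2 = snd u - snd v"
  have orth: "x1 * y1 + x2 * y2 = 0"
    using uv(1) by (simp add: x1_def x2_def y1_def y2_def rhombic_def sqnorm_def algebra_simps power2_eq_square)
  define X where "X = x1 ^ 2 + x2 ^ 2"
  define W where "W = x1 * y2 - x2 * y1"
  have W: "W > 0" using uv(3) by (simp add: W_def x1_def x2_def y1_def y2_def det2_def algebra_simps)
  have X: "X > 0"
  proof -
    have "x1 \<noteq> 0 \<or> x2 \<noteq> 0" using W by (auto simp: W_def)
    then show ?thesis by (simp add: X_def sum_power2_gt_zero_iff)
  qed
  have rot: "X * y1 = - (W * x2)" "X * y2 = W * x1"
    using orth unfolding X_def W_def by algebra+
  obtain a b g where g: "X = a * g" "W = b * g" "coprime a b" "g > 0"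
  proof -
    have "gcd X W \<noteq> 0" using X by simp
    from gcd_coprime_exists[OF this] obtain a b where "X = a * gcd X W" "W = b * gcd X W" "coprime a b" by blast
    then show ?thesis using that \<open>gcd X W \<noteq> 0\<close> by (metis gcd_pos_int gcd_eq_0_iff)
  qed
  have ab: "a > 0" "b > 0" using X W g by (simp_all add: zero_less_mult_iff)
  have "(a * y1) * g = (- (b * x2)) * g" "(a * y2) * g = (b * x1) * g"
    using rot unfolding g by (simp_all add: algebra_simps)
  then have rot': "a * y1 = - (b * x2)" "a * y2 = b * x1" using g(4) by (simp_all only: mult_cancel_right) auto
  have "a dvd b * x2" "a dvd b * x1" using rot' by (metis dvd_minus_iff dvd_triv_left)+
  then have "a dvd x1" "a dvd x2" using g(3) by (simp_all add: coprime_dvd_mult_right_iff)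
  then obtain m n where mn: "x1 = a * m" "x2 = a * n" by (auto elim!: dvdE)
  have "a * y1 = a * (- (b * n))" "a * y2 = a * (b * m)"
    using rot' unfolding mn by (simp_all add: algebra_simps)
  then have yy: "y1 = - (b * n)" "y2 = b * m" using ab by (simp_all only: mult_cancel_left) auto
  have uv_eq: "2 * fst u = a * m - b * n" "2 * snd u = a * n + b * m"
    "2 * fst v = a * m + b * n" "2 * snd v = a * n - b * m"
    using mn yy by (simp_all add: x1_def x2_def y1_def y2_def)
  have found: "L \<in> rhombus_lattice ` rhombus_params"
    if "zspan2 u' v' = L" "rhombic u' v'" "0 < a'" "0 < b'" "coprime a' b'" "0 < m'" "- m' \<le> n'" "n' < m'"
      and eqs: "2 * fst u' = a' * m' - b' * n'" "2 * snd u' = a' * n' + b' * m'"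
    "2 * fst v' = a' * m' + b' * n'" "2 * snd v' = a' * n' - b' * m'" for u' v' a' b' m' n'
  proof -
    note id = rhombus_vectors_identities[OF eqs]
    have Z: "m' ^ 2 + n' ^ 2 > 0" using that(6) by (simp add: add_pos_nonneg)
    have "a' ^ 2 < 3 * b' ^ 2 \<and> b' ^ 2 < 3 * a' ^ 2"
      using rhombus_ratio_iff[OF Z id(1,3)] that(2) by (simp add: rhombic_def)
    moreover have "even (a' * m' + b' * n')" "even (a' * n' + b' * m')"
      by (simp_all flip: eqs)
    ultimately have par: "((m', n'), (a', b')) \<in> rhombus_params"
      using that by (simp add: rhombus_params_iff)
    have "rhombus_u ((m', n'), (a', b')) = u'" "rhombus_v ((m', n'), (a', b')) = v'"
      using rhombus_vectors(1-4)[OF par] eqs by (simp_all add: prod_eq_iff)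
    then have "L = rhombus_lattice ((m', n'), (a', b'))" using that(1) by (simp add: rhombus_lattice_def)
    then show ?thesis using par by blast
  qed
  have rh: "rhombic (- u) (- v)" "rhombic v (- u)" "rhombic (- v) u"
  proof -
    have "sqnorm (- w) = sqnorm w" "dot2 (- w) z = - dot2 w z" "dot2 w (- z) = - dot2 w z" "dot2 v u = dot2 u v" for w z
      by (simp_all add: sqnorm_def dot2_def algebra_simps)
    then show "rhombic (- u) (- v)" "rhombic v (- u)" "rhombic (- v) u"
      using uv(1) by (simp_all add: rhombic_def)
  qed
  have sp: "zspan2 (- u) (- v) = L" "zspan2 v (- u) = L" "zspan2 (- v) u = L"
    using uv(2) zspan2_swap by (simp_all add: zspan2_uminus)
  have "m \<noteq> 0 \<or> n \<noteq> 0" using X by (auto simp: X_def mn)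
  \<comment> \<open>The quarter turns of the half-open sector cover every nonzero \<open>z\<close>.
    A half turn negates \<open>u\<close> and \<open>v\<close>; a turn by 90 degrees either way also
    exchanges the roles of the diagonals, hence \<open>a\<close> and \<open>b\<close>.\<close>
  then consider "0 < m" "- m \<le> n" "n < m" | "0 < - m" "- (- m) \<le> - n" "- n < - m"
    | "0 < n" "- n \<le> - m" "- m < n" | "0 < - n" "- (- n) \<le> m" "m < - n"
    by linarith
  then show ?thesis
  proof cases
    case 1
    then show ?thesis using found[of u v a b m n] uv ab g(3) uv_eq by simp
  next
    case 2
    then show ?thesis using found[OF sp(1) rh(1), of a b "- m" "- n"] ab g(3) uv_eq by simp
  next
    case 3
    then show ?thesis using found[OF sp(2) rh(2), of b a n "- m"] ab g(3) uv_eq by (simp add: coprime_commute)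
  next
    case 4
    then show ?thesis using found[OF sp(3) rh(3), of b a "- n" m] ab g(3) uv_eq by (simp add: coprime_commute)
  qed
qed

lemma bij_betw_rhombus_lattice: "bij_betw rhombus_lattice rhombus_params WR_Z2"
proof -
  have "rhombus_lattice x \<in> WR_Z2" if "x \<in> rhombus_params" for x
  proof -
    obtain m n a b where x: "x = ((m, n), (a, b))" by (metis surj_pair)
    show ?thesis
      using rhombic_in_WR[OF rhombus_vectors(5)[OF that[unfolded x]]] by (simp add: x rhombus_lattice_def)
  qed
  then show ?thesis using rhombus_lattice_inj rhombus_lattice_surj by (auto simp: bij_betw_def)
qed

lemma lattice_det_rhombus:
  assumes "((m, n), (a, b)) \<in> rhombus_params"
  shows "lattice_det (rhombus_lattice ((m, n), (a, b))) = real_of_int (m ^ 2 + n ^ 2) * (1 / 2 * real_of_int (a * b))"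
proof -
  note uv = rhombus_vectors[OF assms]
  note id = rhombus_vectors_identities[OF uv(1-4)]
  have "a * b * (m ^ 2 + n ^ 2) \<ge> 0" using assms by (simp add: rhombus_params_iff)
  then have "2 * \<bar>det2 (rhombus_u ((m, n), (a, b))) (rhombus_v ((m, n), (a, b)))\<bar> = a * b * (m ^ 2 + n ^ 2)"
    using id(4) by linarith
  then have "2 * real_of_int \<bar>det2 (rhombus_u ((m, n), (a, b))) (rhombus_v ((m, n), (a, b)))\<bar> = real_of_int (a * b * (m ^ 2 + n ^ 2))"
    by (metis of_int_mult of_int_numeral)
  then show ?thesis
    unfolding rhombus_lattice_def lattice_det_zspan2[OF rhombic_det2_nonzero[OF uv(5)]] by (simp add: field_simps)
qed

lemma lattice_min_rhombus:
  assumes "((m, n), (a, b)) \<in> rhombus_params"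
  shows "lattice_min (rhombus_lattice ((m, n), (a, b))) ^ 2 = real_of_int (m ^ 2 + n ^ 2) * (1 / 4 * real_of_int (a ^ 2 + b ^ 2))"
proof -
  note uv = rhombus_vectors[OF assms]
  note id = rhombus_vectors_identities[OF uv(1-4)]
  have "sqnorm (rhombus_u ((m, n), (a, b))) \<ge> 0" using uv(5) by (auto simp: rhombic_def)
  then have "4 * lattice_min (rhombus_lattice ((m, n), (a, b))) ^ 2 = real_of_int (4 * sqnorm (rhombus_u ((m, n), (a, b))))"
    unfolding rhombus_lattice_def lattice_min_rhombic[OF uv(5)] by simp
  then show ?thesis unfolding id(1) by (simp add: field_simps)
qed

section \<open>Double poles of the lattice zeta functions\<close>

text \<open>Determinant and squared minimum both split as \<open>m^2 + n^2\<close> times a function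
  \<open>G\<close> of \<open>(a, b)\<close>, so each of the two products of index sets contributes
  order \<open>1 + 1\<close>. The factor \<open>1 *\<close> is the constant \<open>c\<close> of the
  norm form.\<close>

lemma rhombus_params_pole:
  fixes G :: "int \<times> int \<Rightarrow> real"
  assumes "dirichlet_pole 1 G (sector (1 / sqrt 3) (sqrt 3) \<inter> {(a, b). odd a \<and> odd b} \<inter> {(a, b). coprime a b})"
    and "dirichlet_pole 1 G (sector (1 / sqrt 3) (sqrt 3) \<inter> {(a, b). even a \<longleftrightarrow> odd b} \<inter> {(a, b). coprime a b})"
  shows "dirichlet_pole 2 (\<lambda>(z, y). (case z of (m, n) \<Rightarrow> 1 * real_of_int (m ^ 2 + n ^ 2)) * G y) rhombus_params"
proof -
  have "dirichlet_pole (1 + 1) (\<lambda>(z, y). (case z of (m, n) \<Rightarrow> 1 * real_of_int (m ^ 2 + n ^ 2)) * G y) rhombus_params"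
    unfolding rhombus_params_def
    by (intro dirichlet_pole_Un dirichlet_pole_Times sector_norm_poles assms) auto
  then show ?thesis by (simp only: one_add_one)
qed

lemma inverse_sqrt3: "0 < 1 / sqrt (3 :: real)" "1 / sqrt 3 < sqrt (3 :: real)"
  by (simp_all add: field_simps)

lemma WR_det_pole: "dirichlet_pole 2 lattice_det WR_Z2"
proof (rule dirichlet_pole_bij_betw[OF bij_betw_rhombus_lattice])
  show "dirichlet_pole 2 (\<lambda>(z, y). (case z of (m, n) \<Rightarrow> 1 * real_of_int (m ^ 2 + n ^ 2)) *
      (case y of (a, b) \<Rightarrow> 1 / 2 * real_of_int (a * b))) rhombus_params"
    by (intro rhombus_params_pole sector_product_coprime_poles inverse_sqrt3) auto
qed (auto simp: lattice_det_rhombus)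

lemma WR_min_pole: "dirichlet_pole 2 (\<lambda>L. lattice_min L ^ 2) WR_Z2"
proof (rule dirichlet_pole_bij_betw[OF bij_betw_rhombus_lattice])
  show "dirichlet_pole 2 (\<lambda>(z, y). (case z of (m, n) \<Rightarrow> 1 * real_of_int (m ^ 2 + n ^ 2)) *
      (case y of (a, b) \<Rightarrow> 1 / 4 * real_of_int (a ^ 2 + b ^ 2))) rhombus_params"
    by (intro rhombus_params_pole sector_norm_poles inverse_sqrt3) auto
qed (auto simp: lattice_min_rhombus)

lemma dirichlet_poleD:
  assumes "dirichlet_pole m F X"
  shows "Re s > 1 \<Longrightarrow> (\<lambda>x. norm (complex_of_real (F x) powr (- s))) summable_on X"
    and "(\<lambda>s. \<Sum>\<^sub>\<infinity>x\<in>X. complex_of_real (F x) powr (- s)) analytic_on {s. Re s > 1}"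
    and "\<exists>c>0. ((\<lambda>s. (s - 1) ^ m * (\<Sum>\<^sub>\<infinity>x\<in>X. F x powr (- s))) \<longlongrightarrow> c) (at_right 1)"
  using assms unfolding dirichlet_pole_def
  by (auto intro!: dirichlet_series_abs_summable dirichlet_series_analytic)

lemma lattice_min_pos:
  assumes "L \<in> WR_Z2"
  shows "lattice_min L > 0"
proof -
  obtain u v where uv: "rhombic u v" "L = zspan2 u v" using WR_imp_rhombic[OF assms] .
  have "sqnorm u > 0" using uv(1) by (auto simp: rhombic_def)
  then show ?thesis by (simp add: uv(2) lattice_min_rhombic[OF uv(1)])
qed

text \<open>Bridges the exponent \<open>- 2 * s\<close> on the minimum and the pole known for the
  squared minimum. For a positive real base the principal logarithm of the square is twice that of
  the base, so no branch correction appears.\<close>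

lemma powr_square_base:
  fixes x :: real
  assumes "x > 0"
  shows "complex_of_real x powr (- 2 * s) = complex_of_real (x ^ 2) powr (- s)"
    and "x powr (- 2 * t) = (x ^ 2) powr (- t)"
proof -
  have "Ln (complex_of_real (x ^ 2)) = 2 * Ln (complex_of_real x)"
    using assms by (simp only: Ln_of_real zero_less_power) (simp add: ln_realpow)
  moreover have "complex_of_real (x ^ 2) \<noteq> 0" "complex_of_real x \<noteq> 0" using assms by simp_all
  ultimately show "complex_of_real x powr (- 2 * s) = complex_of_real (x ^ 2) powr (- s)"
    unfolding powr_def by (simp add: mult.assoc mult.left_commute)
  show "x powr (- 2 * t) = (x ^ 2) powr (- t)"
    using assms by (simp add: powr_powr flip: powr_numeral)
qed

theorem theorem1p5:
  shows
    \<comment> \<open>W_d: absolute convergence, analyticity, simple pole at 1\<close>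
    "(\<forall>s::complex. Re s > 1 \<longrightarrow>
        (\<lambda>(p, q). norm (complex_of_nat p powr (- s))) summable_on S_set)
   \<and> (\<lambda>s. \<Sum>\<^sub>\<infinity>(p, q)\<in>S_set. complex_of_nat p powr (- s)) analytic_on {s. Re s > 1}
   \<and> (\<exists>c>0. ((\<lambda>s::real. (s - 1) * (\<Sum>\<^sub>\<infinity>(p, q)\<in>S_set. real p powr (- s)))
               \<longlongrightarrow> c) (at_right 1))
   \<and> (\<forall>s::complex. Re s > 1 \<longrightarrow>
        (\<lambda>(p, q). norm (complex_of_nat q powr (- s))) summable_on S_set)
   \<and> (\<lambda>s. \<Sum>\<^sub>\<infinity>(p, q)\<in>S_set. complex_of_nat q powr (- s)) analytic_on {s. Re s > 1}
   \<and> (\<exists>c>0. ((\<lambda>s::real. (s - 1) * (\<Sum>\<^sub>\<infinity>(p, q)\<in>S_set. real q powr (- s)))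
               \<longlongrightarrow> c) (at_right 1))
   \<and> (\<forall>s::complex. Re s > 1 \<longrightarrow>
        (\<lambda>L. norm (complex_of_real (lattice_det L) powr (- s))) summable_on WR_Z2)
   \<and> (\<lambda>s. \<Sum>\<^sub>\<infinity>L\<in>WR_Z2. complex_of_real (lattice_det L) powr (- s)) analytic_on {s. Re s > 1}
   \<and> (\<exists>c>0. ((\<lambda>s::real. (s - 1) ^ 2 * (\<Sum>\<^sub>\<infinity>L\<in>WR_Z2. lattice_det L powr (- s)))
               \<longlongrightarrow> c) (at_right 1))
   \<and> (\<forall>s::complex. Re s > 1 \<longrightarrow>
        (\<lambda>L. norm (complex_of_real (lattice_min L) powr (- 2 * s))) summable_on WR_Z2)
   \<and> (\<lambda>s. \<Sum>\<^sub>\<infinity>L\<in>WR_Z2. complex_of_real (lattice_min L) powr (- 2 * s)) analytic_on {s. Re s > 1}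
   \<and> (\<exists>c>0. ((\<lambda>s::real. (s - 1) ^ 2 * (\<Sum>\<^sub>\<infinity>L\<in>WR_Z2. lattice_min L powr (- 2 * s)))
               \<longlongrightarrow> c) (at_right 1))"
proof -
  note D = dirichlet_poleD[OF S_set_numerator_pole] and M = dirichlet_poleD[OF S_set_denominator_pole]
    and WD = dirichlet_poleD[OF WR_det_pole] and WM = dirichlet_poleD[OF WR_min_pole]
  note WM' = powr_square_base[OF lattice_min_pos]
  have WM1: "(\<lambda>L. norm (complex_of_real (lattice_min L) powr (- 2 * s))) summable_on WR_Z2" if "Re s > 1" for s
    using WM(1)[OF that] by (simp only: WM' cong: summable_on_cong)
  have WM2: "(\<lambda>s. \<Sum>\<^sub>\<infinity>L\<in>WR_Z2. complex_of_real (lattice_min L) powr (- 2 * s)) analytic_on {s. Re s > 1}"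
    using WM(2) by (simp only: WM' cong: infsum_cong)
  have WM3: "\<exists>c>0. ((\<lambda>s. (s - 1) ^ 2 * (\<Sum>\<^sub>\<infinity>L\<in>WR_Z2. lattice_min L powr (- 2 * s))) \<longlongrightarrow> c) (at_right 1)"
    using WM(3) by (simp only: WM' cong: infsum_cong)
  show ?thesis
    using D M WD WM1 WM2 WM3 by (simp add: case_prod_unfold)
qed

end
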